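(* Assume that the third-order ODEs $$u'''=f(x,u,u',u''),\qquad \bar u'''=\frac32\frac{\bar q^{2}}{\bar p}$$ (where $\bar p=\bar u'$, $\bar q=\bar u''$) are equivalent with respect to a point transformation $\bar x=\varphi(x,u)$, $\bar u=\psi(x,u)$, $\varphi_x\psi_u-\varphi_u\psi_x\neq0$. Then the point transformation between them is determined by the following system, i.e. there are auxiliary functions $a_1(x,u,p)$ and $a_2(x,u,p,q)$ such that, for a suitable choice of the square root $J_5$, the following equations hold: $$\hat D_xa_2=-\frac{b_{16}}{b_{17}},\quad a_{2_u}=-\frac{b_{13}}{b_{17}},\quad a_{2_p}=-\frac{b_{14}}{b_{17}},\quad a_{2_q}=-\frac{b_{15}}{b_{17}},$$ $$\hat D_xa_1=-\frac{b_{11}}{b_{12}},\quad a_{1_u}=-\frac{b_9}{b_{12}},\quad a_{1_p}=-\frac{b_{10}}{b_{12}},\quad a_{1_q}=0,$$ $$ \begin{aligned} &\hat D_x\eta=b_8\bar f,\quad \eta_u=b_4+b_7\bar f,\quad \eta_p=b_5,\quad \eta_q=b_6,\\ &\hat D_x\chi=b_8\eta,\quad \chi_u=b_2+b_7\eta,\quad \chi_p=b_3,\\ &\hat D_x\varphi=b_8,\quad \varphi_u=b_7,\\ &b_7\hat D_x\psi=b_8(\psi_u-b_1), \end{aligned} $$ where $\chi=\frac{\hat D_x\psi}{\hat D_x\varphi}$, $\eta=\frac{\hat D_x\chi}{\hat D_x\varphi}$, $\bar f=\frac32\frac{\eta^2}{\chi}$, and $$ \begin{pmatrix} b_1&0&0&0&0&0\\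 b_2&b_3&0&0&0&0\\ b_4&b_5&b_6&0&0&0\\ b_7&0&0&b_8&0&0\\ b_9&b_{10}&0&b_{11}&b_{12}&0\\ b_{13}&b_{14}&b_{15}&b_{16}&0&b_{17} \end{pmatrix}= \begin{pmatrix} 1&0&0&0&0&0\\ 0&\frac1{2\chi}&0&0&0&0\\ 0&-\frac{\eta}{4\chi^3}&\frac1{4\chi^2}&0&0&0\\ 1&0&0&2\chi&0&0\\ 0&\frac1{2\chi}&0&0&1&0\\ 0&-\frac{\eta}{4\chi^3}&\frac1{4\chi^2}&0&0&1 \end{pmatrix}^{-1}N, $$ $$ N=\begin{pmatrix} a_1&0&0&0&0&0\\ a_2&J_5&0&0&0&0\\ \frac{a_2^2}{2a_1}+\frac{J_5^2}{2a_1}I_2&\frac{a_2J_5}{a_1}+\frac{J_5^2}{3a_1}I_1&\frac{J_5^2}{a_1}&0&0&0\\ \frac{a_1}{J_5}I_3&0&0&\frac{a_1}{J_5}&0&0\\ I_8&I_3&0&-\frac{a_2}{J_5}&\frac1{a_1}&0\\ I_9&I_{10}&\frac{I_3J_5}{a_1}&-\frac1{2a_1}\left(I_2J_5+\frac{a_2^2}{J_5}\right)&0&\frac1{a_1} \end{pmatrix}. $$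
   Context: Everything is local and over the complex numbers. $(x,u,p,q)$, with $p=u'$, $q=u''$, are local coordinates on the second-order jet space. Put $\hat D_x=\partial_x+p\,\partial_u+q\,\partial_p+f\,\partial_q$; letter subscripts denote partial derivatives (e.g. $I_{1_q}=\partial I_1/\partial q$, $a_{2_u}=\partial a_2/\partial u$). For the ODE $u'''=f(x,u,p,q)$ define $$I_1=-f_q,\qquad I_2=-\tfrac29I_1^2-f_p-\tfrac13\hat D_xI_1,\qquad I_3=-\tfrac16I_{1_q},\qquad I_5=J_5^2=-I_3^2-I_{3_p},$$ so $J_5$ is a square root of $-I_3^2-I_{3_p}$, and, in terms of the auxiliary functions $a_1,a_2$ (with $a_1\neq0$), $$I_8=\frac{1}{6J_5}\left(4I_{1_p}J_5-9I_{2_q}J_5+8I_1I_3J_5-6I_3a_2\right),$$ $$I_9=\frac{1}{18J_5a_1}\Big(-3f_{pp}J_5^2-2J_5I_{1_p}(I_1J_5-6a_2)+3J_5I_{2_q}(I_1J_5-9a_2)-9I_{2_p}J_5^2-2I_3\big(J_5^2(I_1^2-\tfrac92I_2)-12I_1J_5a_2+\tfrac92a_2^2\big)\Big),$$ $$I_{10}=\frac{1}{3a_1}\left(J_5(I_{1_p}-3I_{2_q})+3I_3(I_1J_5+a_2)\right).$$ *)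

theory Defs
  imports "HOL-Analysis.Analysis"
begin

section \<open>Holomorphic functions of several variables\<close>

definition holomorphic_several :: "(complex^'n \<Rightarrow> complex) \<Rightarrow> (complex^'n) set \<Rightarrow> bool"
  where "holomorphic_several F U \<longleftrightarrow>
    (\<forall>z\<in>U. \<exists>c::complex^'n. (F has_derivative (\<lambda>h. \<Sum>i\<in>UNIV. c $ i * h $ i)) (at z))"

definition pd :: "'n \<Rightarrow> (complex^'n \<Rightarrow> complex) \<Rightarrow> complex^'n \<Rightarrow> complex"
  where "pd i F z = deriv (\<lambda>w. F (\<chi> j. if j = i then w else z $ j)) (z $ i)"


section \<open>Jets and total derivatives\<close>

text \<open>
  A point \<open>z\<close> of the second-order jet space has the coordinates
  \<open>x = z $ 1\<close>, \<open>u = z $ 2\<close>, \<open>p = z $ 3\<close>, \<open>q = z $ 4\<close>.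
\<close>

type_synonym jet2 = "complex^4"

definition xu :: "jet2 \<Rightarrow> complex^2"
  where "xu z = vector [z $ 1, z $ 2]"

definition xup :: "jet2 \<Rightarrow> complex^3"
  where "xup z = vector [z $ 1, z $ 2, z $ 3]"

text \<open>
  For \<open>g = f\<close> this is the operator \<open>\<partial>\<^sub>x + p \<partial>\<^sub>u + q \<partial>\<^sub>p + f \<partial>\<^sub>q\<close>; for a constant \<open>g = (\<lambda>_. r)\<close> it
  gives the value, at the third-order jet \<open>(x, u, p, q, r)\<close>, of the unrestricted total derivative
  of a function on the second-order jet space.
\<close>

definition Dhat :: "(jet2 \<Rightarrow> complex) \<Rightarrow> (jet2 \<Rightarrow> complex) \<Rightarrow> jet2 \<Rightarrow> complex"
  where "Dhat g F z = pd 1 F z + z $ 3 * pd 2 F z + z $ 4 * pd 3 F z + g z * pd 4 F z"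


section \<open>Point transformations and equivalence of third-order ODEs\<close>

definition point_transformation ::
    "(complex^2) set \<Rightarrow> (complex^2 \<Rightarrow> complex) \<Rightarrow> (complex^2 \<Rightarrow> complex) \<Rightarrow> bool"
  where "point_transformation V \<phi> \<psi> \<longleftrightarrow>
    holomorphic_several \<phi> V \<and> holomorphic_several \<psi> V \<and>
    (\<forall>y\<in>V. pd 1 \<phi> y * pd 2 \<psi> y - pd 2 \<phi> y * pd 1 \<psi> y \<noteq> 0)"

text \<open>
  The transformed derivatives of order one, two and three. The first two do not depend on \<open>g\<close>,
  since \<open>\<phi>\<close>, \<open>\<psi>\<close> and the transformed first derivative do not depend on \<open>q\<close>.
\<close>

definition pbar ::
    "(jet2 \<Rightarrow> complex) \<Rightarrow> (complex^2 \<Rightarrow> complex) \<Rightarrow> (complex^2 \<Rightarrow> complex) \<Rightarrow> jet2 \<Rightarrow> complex"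
  where "pbar g \<phi> \<psi> z = Dhat g (\<psi> \<circ> xu) z / Dhat g (\<phi> \<circ> xu) z"

definition qbar ::
    "(jet2 \<Rightarrow> complex) \<Rightarrow> (complex^2 \<Rightarrow> complex) \<Rightarrow> (complex^2 \<Rightarrow> complex) \<Rightarrow> jet2 \<Rightarrow> complex"
  where "qbar g \<phi> \<psi> z = Dhat g (pbar g \<phi> \<psi>) z / Dhat g (\<phi> \<circ> xu) z"

definition rbar ::
    "(jet2 \<Rightarrow> complex) \<Rightarrow> (complex^2 \<Rightarrow> complex) \<Rightarrow> (complex^2 \<Rightarrow> complex) \<Rightarrow> jet2 \<Rightarrow> complex"
  where "rbar g \<phi> \<psi> z = Dhat g (qbar g \<phi> \<psi>) z / Dhat g (\<phi> \<circ> xu) z"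

definition prolong2 ::
    "(jet2 \<Rightarrow> complex) \<Rightarrow> (complex^2 \<Rightarrow> complex) \<Rightarrow> (complex^2 \<Rightarrow> complex) \<Rightarrow> jet2 \<Rightarrow> jet2"
  where "prolong2 g \<phi> \<psi> z = vector [\<phi> (xu z), \<psi> (xu z), pbar g \<phi> \<psi> z, qbar g \<phi> \<psi> z]"

text \<open>
  The equations \<open>u''' = f\<close> (over \<open>U\<close>) and \<open>u''' = f'\<close> (over \<open>U'\<close>) are regarded as hypersurfaces
  \<open>r = f (x, u, p, q)\<close> and \<open>r = f' (x, u, p, q)\<close> of the third-order jet space. The point
  transformation establishes the equivalence if its third prolongation is defined over \<open>U\<close> and
  the first hypersurface is precisely the preimage of the second one.
\<close>

definition equivalent_under ::
    "jet2 set \<Rightarrow> (jet2 \<Rightarrow> complex) \<Rightarrow> jet2 set \<Rightarrow> (jet2 \<Rightarrow> complex) \<Rightarrow>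
     (complex^2 \<Rightarrow> complex) \<Rightarrow> (complex^2 \<Rightarrow> complex) \<Rightarrow> bool"
  where "equivalent_under U f U' f' \<phi> \<psi> \<longleftrightarrow>
    point_transformation (xu ` U) \<phi> \<psi> \<and>
    (\<forall>z\<in>U. \<forall>r.
       Dhat (\<lambda>_. r) (\<phi> \<circ> xu) z \<noteq> 0 \<and>
       prolong2 (\<lambda>_. r) \<phi> \<psi> z \<in> U' \<and>
       (r = f z \<longleftrightarrow> rbar (\<lambda>_. r) \<phi> \<psi> z = f' (prolong2 (\<lambda>_. r) \<phi> \<psi> z)))"


section \<open>The invariants\<close>

definition I1 :: "(jet2 \<Rightarrow> complex) \<Rightarrow> jet2 \<Rightarrow> complex"
  where "I1 f z = - pd 4 f z"

definition I2 :: "(jet2 \<Rightarrow> complex) \<Rightarrow> jet2 \<Rightarrow> complex"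
  where "I2 f z = - (2/9) * (I1 f z)^2 - pd 3 f z - (1/3) * Dhat f (I1 f) z"

definition I3 :: "(jet2 \<Rightarrow> complex) \<Rightarrow> jet2 \<Rightarrow> complex"
  where "I3 f z = - (1/6) * pd 4 (I1 f) z"

definition I5 :: "(jet2 \<Rightarrow> complex) \<Rightarrow> jet2 \<Rightarrow> complex"
  where "I5 f z = - ((I3 f z)^2) - pd 3 (I3 f) z"

text \<open>Below, \<open>J\<close>, \<open>a\<^sub>1\<close>, \<open>a\<^sub>2\<close> are the values at \<open>z\<close> of the functions with these names, where \<open>J\<^sup>2 = I5 f z\<close>.\<close>

definition I8 :: "(jet2 \<Rightarrow> complex) \<Rightarrow> complex \<Rightarrow> complex \<Rightarrow> jet2 \<Rightarrow> complex"
  where "I8 f J a\<^sub>2 z = 1 / (6 * J) *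
    (4 * pd 3 (I1 f) z * J - 9 * pd 4 (I2 f) z * J + 8 * I1 f z * I3 f z * J - 6 * I3 f z * a\<^sub>2)"

definition I9 :: "(jet2 \<Rightarrow> complex) \<Rightarrow> complex \<Rightarrow> complex \<Rightarrow> complex \<Rightarrow> jet2 \<Rightarrow> complex"
  where "I9 f J a\<^sub>1 a\<^sub>2 z = 1 / (18 * J * a\<^sub>1) *
    (- 3 * pd 3 (pd 3 f) z * J^2
     - 2 * J * pd 3 (I1 f) z * (I1 f z * J - 6 * a\<^sub>2)
     + 3 * J * pd 4 (I2 f) z * (I1 f z * J - 9 * a\<^sub>2)
     - 9 * pd 3 (I2 f) z * J^2
     - 2 * I3 f z * (J^2 * ((I1 f z)^2 - (9/2) * I2 f z) - 12 * I1 f z * J * a\<^sub>2 + (9/2) * a\<^sub>2^2))"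

definition I10 :: "(jet2 \<Rightarrow> complex) \<Rightarrow> complex \<Rightarrow> complex \<Rightarrow> complex \<Rightarrow> jet2 \<Rightarrow> complex"
  where "I10 f J a\<^sub>1 a\<^sub>2 z = 1 / (3 * a\<^sub>1) *
    (J * (pd 3 (I1 f) z - 3 * pd 4 (I2 f) z) + 3 * I3 f z * (I1 f z * J + a\<^sub>2))"


section \<open>The matrices\<close>

definition Mmat :: "complex \<Rightarrow> complex \<Rightarrow> complex^6^6"
  where "Mmat \<xi> \<eta> = vector
    [vector [1, 0, 0, 0, 0, 0],
     vector [0, 1 / (2 * \<xi>), 0, 0, 0, 0],
     vector [0, - \<eta> / (4 * \<xi>^3), 1 / (4 * \<xi>^2), 0, 0, 0],
     vector [1, 0, 0, 2 * \<xi>, 0, 0],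
     vector [0, 1 / (2 * \<xi>), 0, 0, 1, 0],
     vector [0, - \<eta> / (4 * \<xi>^3), 1 / (4 * \<xi>^2), 0, 0, 1]]"

definition Nmat :: "(jet2 \<Rightarrow> complex) \<Rightarrow> complex \<Rightarrow> complex \<Rightarrow> complex \<Rightarrow> jet2 \<Rightarrow> complex^6^6"
  where "Nmat f J a\<^sub>1 a\<^sub>2 z = vector
    [vector [a\<^sub>1, 0, 0, 0, 0, 0],
     vector [a\<^sub>2, J, 0, 0, 0, 0],
     vector [a\<^sub>2^2 / (2 * a\<^sub>1) + J^2 / (2 * a\<^sub>1) * I2 f z,
             a\<^sub>2 * J / a\<^sub>1 + J^2 / (3 * a\<^sub>1) * I1 f z, J^2 / a\<^sub>1, 0, 0, 0],
     vector [a\<^sub>1 / J * I3 f z, 0, 0, a\<^sub>1 / J, 0, 0],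
     vector [I8 f J a\<^sub>2 z, I3 f z, 0, - a\<^sub>2 / J, 1 / a\<^sub>1, 0],
     vector [I9 f J a\<^sub>1 a\<^sub>2 z, I10 f J a\<^sub>1 a\<^sub>2 z, I3 f z * J / a\<^sub>1,
             - (1 / (2 * a\<^sub>1)) * (I2 f z * J + a\<^sub>2^2 / J), 0, 1 / a\<^sub>1]]"

definition Bmat :: "(nat \<Rightarrow> complex) \<Rightarrow> complex^6^6"
  where "Bmat b = vector
    [vector [b 1, 0, 0, 0, 0, 0],
     vector [b 2, b 3, 0, 0, 0, 0],
     vector [b 4, b 5, b 6, 0, 0, 0],
     vector [b 7, 0, 0, b 8, 0, 0],
     vector [b 9, b 10, 0, b 11, b 12, 0],
     vector [b 13, b 14, b 15, b 16, 0, b 17]]"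

end

theory Submission
  imports Defs "HOL-Complex_Analysis.Cauchy_Integral_Formula"
begin

text \<open>
  Write \<open>\<Phi> = \<phi> \<circ> xu\<close>, \<open>\<Psi> = \<psi> \<circ> xu\<close> and let \<open>d = \<partial>\<^sub>x + p \<partial>\<^sub>u\<close> be the total derivative of functions of
  the base variables. Put \<open>P = d \<Phi>\<close>, \<open>Q = d \<Psi>\<close> and \<open>\<Delta> = \<phi>\<^sub>x \<psi>\<^sub>u - \<phi>\<^sub>u \<psi>\<^sub>x\<close>. Three equations of
  the system force the auxiliary functions:
  \<open>\<xi>\<^sub>p = b\<^sub>3 = 2 \<xi> J\<^sub>5\<close> gives \<open>J\<^sub>5 = \<Delta> / (2 P Q)\<close>, \<open>b\<^sub>8 = P\<close> gives \<open>a\<^sub>1 = \<Delta> / P\<close>, and the equation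
  for \<open>\<xi>\<^sub>u\<close> gives \<open>a\<^sub>2 = (\<xi>\<^sub>u - \<phi>\<^sub>u \<eta>) / (2 \<xi>)\<close>. With these choices every equation of the system is
  an identity in the jets of \<open>\<phi>\<close> and \<open>\<psi>\<close>, and the theorem is the verification of these identities.

  Three observations keep the identities small.

  The target equation says that the Schwarzian derivative of \<open>\<psi>\<close> with respect to \<open>\<phi>\<close> vanishes along
  solutions, that is, \<open>\<phi>\<close> and \<open>\<psi>\<close> have equal Schwarzians. In the third derivative of \<open>u\<close> this is a
  linear equation whose leading coefficient \<open>W = \<Delta> / (P Q)\<close> does not vanish, so \<open>f\<close> is
  an explicit quadratic polynomial in \<open>q\<close> (lemma \<open>ode_imp_eq_f_form\<close>), and \<open>I\<^sub>1\<close>, \<open>I\<^sub>2\<close>, \<open>I\<^sub>3\<close> are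
  polynomials in \<open>q\<close> too.

  If the jets of \<open>\<Phi>\<close> are divided by \<open>P\<close> and the third order ones are completed by lower order
  terms to Schwarzian-like quantities, then they are closed under \<open>\<partial>\<^sub>p\<close> with very short formulas, because
  \<open>[\<partial>\<^sub>p, d] = \<partial>\<^sub>u\<close> and \<open>\<Phi>\<close> does not depend on \<open>p\<close>. The variable \<open>p\<close> itself never occurs.

  Differentials are expanded in the coframe \<open>dx\<close>, \<open>du - p dx\<close>, \<open>dp\<close>, \<open>dq\<close>. The four coefficients of a
  function determine its derivatives by \<open>\<partial>\<^sub>u\<close>, \<open>\<partial>\<^sub>p\<close>, \<open>\<partial>\<^sub>q\<close> and by the total derivative of every
  equation, so each function needs a single table (predicate \<open>cograd\<close>).

  Derivatives of \<open>\<phi>\<close> and \<open>\<psi>\<close> up to order four occur, whereas holomorphy in several variables is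
  defined by the existence of one complex linear derivative. The first part therefore shows, from Cauchy's
  integral formula, that partial derivatives are again holomorphic and commute.
\<close>

section \<open>Holomorphic functions of several variables\<close>

text \<open>
  A complex linear map is determined by its values on the unit vectors, which are the coefficients
  that the definition asks for. This form is preserved by sums, products and compositions.
\<close>

lemma holomorphic_severalI:
  fixes F :: "complex^'n \<Rightarrow> complex"
  assumes "\<And>z. z \<in> U \<Longrightarrow> \<exists>D. (F has_derivative D) (at z) \<and> (\<forall>k h. D (k *s h) = k * D h)"
  shows "holomorphic_several F U"
  unfolding holomorphic_several_def
proof
  fix z assume "z \<in> U"
  then obtain D where D: "(F has_derivative D) (at z)" and hom: "\<And>k h. D (k *s h) = k * D h"
    using assms by blast
  have "D h = (\<Sum>i\<in>UNIV. (\<chi> i. D (axis i 1)) $ i * h $ i)" for h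
  proof -
    have "D h = D (\<Sum>i\<in>UNIV. h $ i *s axis i 1)" by (simp add: basis_expansion)
    also have "\<dots> = (\<Sum>i\<in>UNIV. D (h $ i *s axis i 1))"
      using has_derivative_linear[OF D] by (simp add: linear_sum)
    finally show ?thesis by (simp add: hom mult.commute)
  qed
  then have "D = (\<lambda>h. \<Sum>i\<in>UNIV. (\<chi> i. D (axis i 1)) $ i * h $ i)" by blast
  with D show "\<exists>c. (F has_derivative (\<lambda>h. \<Sum>i\<in>UNIV. c $ i * h $ i)) (at z)" by metis
qed

lemma bounded_linear_axis: "bounded_linear (\<lambda>w. axis i w :: complex^'n)"
  by (rule linear_conv_bounded_linear[THEN iffD1], rule linearI) (auto simp: vec_eq_iff axis_def)

lemma axis0: "axis i 0 = (0 :: complex^'n)"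
  by (simp add: vec_eq_iff axis_def)

lemma norm_axis: "norm (axis i w :: complex^'n) = norm w"
  by (simp add: norm_vec_def L2_set_def axis_def if_distrib[of norm] if_distrib[of "\<lambda>x. x\<^sup>2"]
    cong: if_cong)

lemma has_field_derivative_along_coordinate:
  fixes F :: "complex^'n \<Rightarrow> complex"
  assumes "(F has_derivative (\<lambda>h. \<Sum>j\<in>UNIV. c $ j * h $ j)) (at (\<chi> j. if j = i then w else z $ j))"
  shows "((\<lambda>w. F (\<chi> j. if j = i then w else z $ j)) has_field_derivative c $ i) (at w)"
proof -
  let ?L = "\<lambda>w. (\<chi> j. if j = i then w else z $ j) :: complex^'n"
  have L: "?L = (\<lambda>w. ?L 0 + axis i w)" by (auto simp: vec_eq_iff axis_def)
  have "(?L has_derivative (\<lambda>h. axis i h)) (at w)"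
    by (subst L) (auto intro!: derivative_eq_intros
      simp: bounded_linear_imp_has_derivative bounded_linear_axis)
  then have "((\<lambda>w. F (?L w)) has_derivative (\<lambda>h. \<Sum>j\<in>UNIV. c $ j * axis i h $ j)) (at w)"
    by (rule has_derivative_compose) (use assms in simp)
  moreover have "(\<Sum>j\<in>UNIV. c $ j * axis i h $ j) = c $ i * h" for h
    by (simp add: axis_def if_distrib cong: if_cong)
  ultimately show ?thesis by (simp add: has_field_derivative_def)
qed

lemma pd_eq:
  fixes F :: "complex^'n \<Rightarrow> complex"
  assumes "(F has_derivative (\<lambda>h. \<Sum>j\<in>UNIV. c $ j * h $ j)) (at z)"
  shows "pd i F z = c $ i"
proof -
  have "(\<chi> j. if j = i then z $ i else z $ j) = z" by (simp add: vec_eq_iff)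
  then show ?thesis
    using has_field_derivative_along_coordinate[of F c i "z $ i" z] assms
    by (simp add: pd_def DERIV_imp_deriv)
qed

lemma has_derivative_pd:
  fixes F :: "complex^'n \<Rightarrow> complex"
  assumes "holomorphic_several F U" "z \<in> U"
  shows "(F has_derivative (\<lambda>h. \<Sum>j\<in>UNIV. pd j F z * h $ j)) (at z)"
proof -
  obtain c where c: "(F has_derivative (\<lambda>h. \<Sum>j\<in>UNIV. c $ j * h $ j)) (at z)"
    using assms unfolding holomorphic_several_def by blast
  then show ?thesis using pd_eq[OF c] by simp
qed

lemma continuous_on_holomorphic_several:
  "holomorphic_several F U \<Longrightarrow> continuous_on U F"
  by (meson continuous_at_imp_continuous_on has_derivative_continuous has_derivative_pd)

lemma pd_holomorphic_line:
  fixes F :: "complex^'n \<Rightarrow> complex"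
  assumes "holomorphic_several F U" "z + axis i w \<in> U"
  shows "((\<lambda>w. F (z + axis i w)) has_field_derivative pd i F (z + axis i w)) (at w)"
proof -
  have eq: "z + axis i w = (\<chi> j. if j = i then w + z $ i else z $ j)" for w
    by (auto simp: vec_eq_iff axis_def)
  have "((\<lambda>w. F (\<chi> j. if j = i then w else z $ j)) has_field_derivative
      (\<chi> j. pd j F (z + axis i w)) $ i) (at (w + z $ i))"
    by (rule has_field_derivative_along_coordinate)
      (use has_derivative_pd[OF assms] in \<open>simp add: eq\<close>)
  from DERIV_shift[THEN iffD1, of _ _ w "z $ i", OF this]
  show ?thesis by (simp add: eq)
qed

definition circle_point :: "real \<Rightarrow> real \<Rightarrow> complex"
  where "circle_point r t = of_real r * exp (2 * of_real pi * \<i> * of_real t)"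

lemma norm_circle_point: "0 < r \<Longrightarrow> norm (circle_point r t) = r"
  by (simp add: circle_point_def norm_mult)

lemma continuous_circle_point [continuous_intros]:
  "continuous_on X g \<Longrightarrow> continuous_on X (\<lambda>x. circle_point r (g x))"
  unfolding circle_point_def by (intro continuous_intros)

text \<open>
  Cauchy's formula for the first derivative, in the \<open>i\<close>-th variable and with the circle
  parametrised: the integrand depends on \<open>z\<close> as regularly as \<open>F\<close> does, and not only as \<open>pd i F\<close>.
\<close>

lemma pd_Cauchy:
  fixes F :: "complex^'n \<Rightarrow> complex"
  assumes F: "holomorphic_several F U" and r: "0 < r" and sub: "cball z r \<subseteq> U"
  shows "pd i F z = integral {0..1} (\<lambda>t. F (z + axis i (circle_point r t)) / circle_point r t)"
proof -
  define g where "g = (\<lambda>w. F (z + axis i w))"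
  have inU: "z + axis i w \<in> U" if "w \<in> cball 0 r" for w
    using that sub by (auto simp: dist_norm norm_axis subset_eq)
  have der: "(g has_field_derivative pd i F (z + axis i w)) (at w)" if "w \<in> cball 0 r" for w
    unfolding g_def by (rule pd_holomorphic_line[OF F inU[OF that]])
  have cont: "continuous_on (cball 0 r) g"
    using der by (meson DERIV_continuous continuous_at_imp_continuous_on)
  have hol: "g holomorphic_on ball 0 r"
    using der by (metis ball_subset_cball field_differentiable_at_within field_differentiable_def holomorphic_onI subsetD)
  have "(g has_field_derivative pd i F z) (at 0)"
    using der[of 0] r by (simp add: axis0)
  then have "contour_integral (circlepath 0 r) (\<lambda>u. g u / (u - 0)^2) = 2 * of_real pi * \<i> * pd i F z"
    using Cauchy_contour_integral_circlepath_2[OF cont hol, of 0] r by (simp add: DERIV_imp_deriv)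
  moreover have "contour_integral (circlepath 0 r) (\<lambda>u. g u / (u - 0)^2)
    = integral {0..1} (\<lambda>t. 2 * of_real pi * \<i> * (g (circle_point r t) / circle_point r t))"
    unfolding contour_integral_integral
  proof (rule integral_cong)
    fix t :: real
    have nz: "circle_point r t \<noteq> 0" using norm_circle_point[OF r, of t] r by auto
    have c: "circlepath 0 r t = circle_point r t" by (simp add: circlepath circle_point_def)
    have v: "vector_derivative (circlepath 0 r) (at t) = 2 * of_real pi * \<i> * circle_point r t"
      by (simp add: vector_derivative_circlepath circle_point_def)
    show "g (circlepath 0 r t) / (circlepath 0 r t - 0)\<^sup>2 * vector_derivative (circlepath 0 r) (at t)
      = 2 * of_real pi * \<i> * (g (circle_point r t) / circle_point r t)"
      unfolding c v using nz by (simp add: field_simps power2_eq_square)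
  qed
  ultimately have "2 * of_real pi * \<i> * pd i F z
     = 2 * of_real pi * \<i> * integral {0..1} (\<lambda>t. g (circle_point r t) / circle_point r t)"
    by (simp only: integral_mult_right)
  then show ?thesis by (simp add: g_def)
qed

text \<open>
  The circles of radius \<open>r\<close> about all points of a ball of radius \<open>r\<close> stay in one compact ball, so
  Cauchy's formula holds with the same \<open>r\<close> for all these points.
\<close>

lemma circle_in_cball:
  fixes z0 :: "complex^'n"
  assumes "0 < r" "z \<in> ball z0 r"
  shows "z + axis i (circle_point r t) \<in> cball z0 (2 * r)" "cball z r \<subseteq> cball z0 (2 * r)"
proof -
  have *: "y \<in> cball z0 (2 * r)" if "dist z y \<le> r" for y
    using that assms dist_triangle[of z0 y z] by auto
  show "z + axis i (circle_point r t) \<in> cball z0 (2 * r)"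
    by (rule *) (simp add: dist_norm norm_axis norm_circle_point assms)
  show "cball z r \<subseteq> cball z0 (2 * r)" using * by auto
qed

lemma continuous_on_pd:
  fixes F :: "complex^'n \<Rightarrow> complex"
  assumes F: "holomorphic_several F U" and U: "open U"
  shows "continuous_on U (pd i F)"
proof (rule continuous_at_imp_continuous_on, rule ballI)
  fix z0 assume "z0 \<in> U"
  then obtain e where e: "0 < e" "cball z0 e \<subseteq> U" using U open_contains_cball by blast
  define r where "r = e / 2"
  have r: "0 < r" "cball z0 (2 * r) \<subseteq> U" using e by (auto simp: r_def)
  have inU: "z + axis i (circle_point r t) \<in> U" if "z \<in> ball z0 r" for z t
    using circle_in_cball(1)[OF r(1) that] r(2) by blast
  have "continuous_on (ball z0 r \<times> cbox 0 1)
      (\<lambda>(z, t). F (z + axis i (circle_point r t)) / circle_point r t)"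
  proof -
    have "continuous_on (ball z0 r \<times> cbox 0 1) (\<lambda>x. F (fst x + axis i (circle_point r (snd x))))"
      by (rule continuous_on_compose2[OF continuous_on_holomorphic_several[OF F]])
        (use inU in \<open>auto intro!: continuous_intros bounded_linear.continuous_on[OF bounded_linear_axis]\<close>)
    moreover have "circle_point r t \<noteq> 0" for t using norm_circle_point[OF r(1), of t] r by auto
    ultimately show ?thesis by (auto simp: split_beta intro!: continuous_intros)
  qed
  from integral_continuous_on_param[OF this]
  have "continuous_on (ball z0 r) (pd i F)"
    by (rule continuous_on_eq)
      (subst pd_Cauchy[OF F r(1)], use circle_in_cball(2)[OF r(1)] r(2) in \<open>auto simp: cbox_interval\<close>)
  then show "isCont (pd i F) z0" using r(1) by (simp add: continuous_on_eq_continuous_at)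
qed

text \<open>The Leibniz rule is stated for derivatives that are bounded linear functions as objects.\<close>

definition coordinate :: "'n::finite \<Rightarrow> (complex^'n) \<Rightarrow>\<^sub>L complex"
  where "coordinate j = Blinfun (\<lambda>h. h $ j)"

lemma coordinate_apply [simp]: "blinfun_apply (coordinate j) h = h $ j"
  unfolding coordinate_def by (subst bounded_linear_Blinfun_apply) (auto intro: bounded_linear_vec_nth)

text \<open>
  Differentiation of Cauchy's formula under the integral sign. The Leibniz rule needs a derivative of the
  integrand that is jointly continuous; it is the one with coefficients \<open>pd j F\<close>, whose continuity is
  \<open>continuous_on_pd\<close>. The coefficients that result are again Cauchy integrals, which is
  what makes \<open>pd_commute\<close> immediate.
\<close>

lemma has_derivative_pd_pd:
  fixes F :: "complex^'n \<Rightarrow> complex"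
  assumes F: "holomorphic_several F U" and r: "0 < r" and sub: "cball z0 (2 * r) \<subseteq> U" and U: "open U"
  shows "(pd i F has_derivative (\<lambda>h. \<Sum>j\<in>UNIV.
    integral {0..1} (\<lambda>t. pd j F (z0 + axis i (circle_point r t)) / circle_point r t) * h $ j)) (at z0)"
proof -
  define G where "G = (\<lambda>z t. F (z + axis i (circle_point r t)) / circle_point r t)"
  define c where "c = (\<lambda>j z t. pd j F (z + axis i (circle_point r t)) / circle_point r t)"
  define G' where "G' = (\<lambda>z t. \<Sum>j\<in>UNIV. blinfun_mult_right (c j z t) o\<^sub>L coordinate j)"
  have nz: "circle_point r t \<noteq> 0" for t using norm_circle_point[OF r(1), of t] r by auto
  have inU: "z + axis i (circle_point r t) \<in> U" if "z \<in> ball z0 r" for z t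
    using circle_in_cball(1)[OF r that] sub by blast
  have cont: "continuous_on (ball z0 r \<times> cbox 0 1) (\<lambda>x. H (fst x + axis i (circle_point r (snd x))) / circle_point r (snd x))"
    if "continuous_on U H" for H
    by (intro continuous_intros nz ballI continuous_on_compose2[OF that])
        (use inU in \<open>auto intro!: continuous_intros bounded_linear.continuous_on[OF bounded_linear_axis]\<close>)
  have contc: "continuous_on (ball z0 r \<times> cbox 0 1) (\<lambda>x. c j (fst x) (snd x))" for j
    unfolding c_def by (rule cont[OF continuous_on_pd[OF F U]])
  have pair: "continuous_on X (Pair z)" for z :: "complex^'n" and X :: "real set"
    by (rule continuous_on_Pair) (auto intro: continuous_intros)
  have slice: "continuous_on (cbox 0 1) (h z)"
    if "continuous_on (ball z0 r \<times> cbox 0 1) (\<lambda>x. h (fst x) (snd x))" "z \<in> ball z0 r"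
    for h :: "complex^'n \<Rightarrow> real \<Rightarrow> complex" and z
    using continuous_on_compose2[OF that(1) pair, of z "cbox 0 1"] that(2) by (simp add: image_subset_iff)
  have contG': "continuous_on (ball z0 r \<times> cbox 0 1) (\<lambda>(z, t). G' z t)"
    unfolding G'_def split_beta
    by (intro continuous_intros bounded_linear.continuous_on[OF bounded_linear_blinfun_mult_right]
       bounded_bilinear.continuous_on[OF bounded_bilinear_blinfun_compose] contc)
  have appl: "blinfun_apply (G' z t) h = (\<Sum>j\<in>UNIV. c j z t * h $ j)" for z t h
    by (simp add: G'_def blinfun.sum_left mult.commute)
  have "((\<lambda>z. integral (cbox 0 1) (G z)) has_derivative integral (cbox 0 1) (G' z0)) (at z0 within ball z0 r)"
  proof (rule leibniz_rule[OF _ _ contG'])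
    show "z0 \<in> ball z0 r" using r by simp
    fix z assume z: "z \<in> ball z0 r"
    show "G z integrable_on cbox 0 1"
      by (rule integrable_continuous, rule slice[OF _ z], unfold G_def)
       (rule cont[OF continuous_on_holomorphic_several[OF F]])
    fix t :: real
    have "((\<lambda>z. F (z + axis i (circle_point r t))) has_derivative
        (\<lambda>h. \<Sum>j\<in>UNIV. pd j F (z + axis i (circle_point r t)) * h $ j)) (at z)"
      by (rule has_derivative_compose[of "\<lambda>z. z + axis i (circle_point r t)" "\<lambda>h. h"])
        (use has_derivative_pd[OF F inU[OF z]] in \<open>auto intro!: derivative_eq_intros\<close>)
    from has_derivative_divide'[OF this has_derivative_const[of "circle_point r t"] nz]
    have "((\<lambda>z. G z t) has_derivative (\<lambda>h. \<Sum>j\<in>UNIV. c j z t * h $ j)) (at z)"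
      unfolding G_def c_def
      by (rule has_derivative_eq_rhs) (auto simp: nz sum_divide_distrib fun_eq_iff)
    then show "((\<lambda>z. G z t) has_derivative blinfun_apply (G' z t)) (at z within ball z0 r)"
      unfolding appl by (simp add: has_derivative_at_withinI)
  qed auto
  then have "((\<lambda>z. integral (cbox 0 1) (G z)) has_derivative integral (cbox 0 1) (G' z0)) (at z0)"
    using r by (simp add: at_within_open[where S = "ball z0 r"])
  then have *: "(pd i F has_derivative integral (cbox 0 1) (G' z0)) (at z0)"
  proof (rule has_derivative_transform_within_open[where s = "ball z0 r"])
    fix z assume "z \<in> ball z0 r"
    then show "integral (cbox 0 1) (G z) = pd i F z"
      unfolding G_def cbox_interval
      by (intro pd_Cauchy[OF F r, symmetric]) (use circle_in_cball(2)[OF r] sub in auto)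
  qed (use r in auto)
  have "blinfun_apply (integral (cbox 0 1) (G' z0)) h
      = (\<Sum>j\<in>UNIV. integral {0..1} (c j z0) * h $ j)" for h
  proof -
    have z0: "z0 \<in> ball z0 r" using r by simp
    have ic: "c j z0 integrable_on cbox 0 1" for j
      by (rule integrable_continuous, rule slice[OF contc z0])
    have "continuous_on (cbox 0 1) (G' z0)"
      using continuous_on_compose2[OF contG' pair, of z0 "cbox 0 1"] z0 by (simp add: image_subset_iff)
    then have "blinfun_apply (integral (cbox 0 1) (G' z0)) h
      = integral (cbox 0 1) (\<lambda>t. \<Sum>j\<in>UNIV. c j z0 t * h $ j)"
      by (subst blinfun_apply_integral) (auto simp: appl intro: integrable_continuous_interval)
    also have "\<dots> = (\<Sum>j\<in>UNIV. integral (cbox 0 1) (\<lambda>t. c j z0 t * h $ j))"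
      by (rule integral_sum) (use integrable_on_mult_left[OF ic] in auto)
    finally show ?thesis by (simp add: cbox_interval)
  qed
  then have "blinfun_apply (integral (cbox 0 1) (G' z0)) = (\<lambda>h. \<Sum>j\<in>UNIV. integral {0..1} (c j z0) * h $ j)"
    by blast
  with * show ?thesis by (simp add: c_def)
qed

lemma ex_cball_double:
  assumes "open U" "z \<in> U" obtains r where "0 < r" "cball z (2 * r) \<subseteq> U"
proof -
  obtain e where e: "0 < e" "cball z e \<subseteq> U" using assms open_contains_cball by blast
  from e that[of "e/2"] show thesis by auto
qed

lemma holomorphic_several_pd:
  assumes F: "holomorphic_several F U" and U: "open U"
  shows "holomorphic_several (pd i F) U"
  unfolding holomorphic_several_def
proof
  fix z assume "z \<in> U"
  then obtain r where r: "0 < r" "cball z (2 * r) \<subseteq> U" using U ex_cball_double by blast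
  show "\<exists>c. (pd i F has_derivative (\<lambda>h. \<Sum>j\<in>UNIV. c $ j * h $ j)) (at z)"
    using has_derivative_pd_pd[OF F r U]
    by (intro exI[of _ "\<chi> j. integral {0..1} (\<lambda>t. pd j F (z + axis i (circle_point r t)) / circle_point r t)"]) simp
qed

lemma pd_commute:
  assumes F: "holomorphic_several F U" and U: "open U" and z: "z \<in> U"
  shows "pd j (pd i F) z = pd i (pd j F) z"
proof -
  obtain r where r: "0 < r" "cball z (2 * r) \<subseteq> U" using U z ex_cball_double by blast
  have "pd j (pd i F) z = (\<chi> j. integral {0..1} (\<lambda>t. pd j F (z + axis i (circle_point r t)) / circle_point r t)) $ j"
    by (rule pd_eq) (use has_derivative_pd_pd[OF F r U] in simp)
  also have "\<dots> = pd i (pd j F) z"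
    using pd_Cauchy[OF holomorphic_several_pd[OF F U] r(1), of z i j] r circle_in_cball(2)[of r z z] by auto
  finally show ?thesis .
qed

lemma holomorphic_several_const [simp]: "holomorphic_several (\<lambda>_. c) U"
  by (rule holomorphic_severalI) (auto intro!: exI[of _ "\<lambda>_. 0"])

lemma holomorphic_several_component [simp]: "holomorphic_several (\<lambda>z. z $ i) U"
  by (rule holomorphic_severalI)
    (auto intro!: exI[of _ "\<lambda>h. h $ i"] derivative_eq_intros bounded_linear_imp_has_derivative bounded_linear_vec_nth)

lemma holomorphic_several_homogeneous_derivative:
  assumes "holomorphic_several F U" "z \<in> U"
  shows "\<exists>D. (F has_derivative D) (at z) \<and> (\<forall>k h. D (k *s h) = k * D h)"
  by (rule exI, rule conjI, rule has_derivative_pd[OF assms]) (simp add: sum_distrib_left mult_ac)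

lemma holomorphic_several_add:
  assumes "holomorphic_several F U" "holomorphic_several G U"
  shows "holomorphic_several (\<lambda>z. F z + G z) U"
proof (rule holomorphic_severalI)
  fix z assume z: "z \<in> U"
  obtain D where D: "(F has_derivative D) (at z)" "\<And>k h. D (k *s h) = k * D h"
    using holomorphic_several_homogeneous_derivative[OF assms(1) z] by blast
  obtain D' where D': "(G has_derivative D') (at z)" "\<And>k h. D' (k *s h) = k * D' h"
    using holomorphic_several_homogeneous_derivative[OF assms(2) z] by blast
  show "\<exists>D. ((\<lambda>z. F z + G z) has_derivative D) (at z) \<and> (\<forall>k h. D (k *s h) = k * D h)"
    by (rule exI, rule conjI, rule has_derivative_add[OF D(1) D'(1)]) (simp add: D D' algebra_simps)
qed

lemma holomorphic_several_mult:
  assumes "holomorphic_several F U" "holomorphic_several G U"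
  shows "holomorphic_several (\<lambda>z. F z * G z) U"
proof (rule holomorphic_severalI)
  fix z assume z: "z \<in> U"
  obtain D where D: "(F has_derivative D) (at z)" "\<And>k h. D (k *s h) = k * D h"
    using holomorphic_several_homogeneous_derivative[OF assms(1) z] by blast
  obtain D' where D': "(G has_derivative D') (at z)" "\<And>k h. D' (k *s h) = k * D' h"
    using holomorphic_several_homogeneous_derivative[OF assms(2) z] by blast
  show "\<exists>D. ((\<lambda>z. F z * G z) has_derivative D) (at z) \<and> (\<forall>k h. D (k *s h) = k * D h)"
    by (rule exI, rule conjI, rule has_derivative_mult[OF D(1) D'(1)]) (simp add: D D' algebra_simps)
qed

lemma holomorphic_several_inverse:
  assumes "holomorphic_several F U" "\<And>z. z \<in> U \<Longrightarrow> F z \<noteq> 0"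
  shows "holomorphic_several (\<lambda>z. inverse (F z)) U"
proof (rule holomorphic_severalI)
  fix z assume z: "z \<in> U"
  obtain D where D: "(F has_derivative D) (at z)" "\<And>k h. D (k *s h) = k * D h"
    using holomorphic_several_homogeneous_derivative[OF assms(1) z] by blast
  show "\<exists>D. ((\<lambda>z. inverse (F z)) has_derivative D) (at z) \<and> (\<forall>k h. D (k *s h) = k * D h)"
    by (rule exI, rule conjI, rule Deriv.has_derivative_inverse[OF assms(2)[OF z] D(1)]) (simp add: D)
qed

lemma holomorphic_several_divide:
  assumes "holomorphic_several F U" "holomorphic_several G U" "\<And>z. z \<in> U \<Longrightarrow> G z \<noteq> 0"
  shows "holomorphic_several (\<lambda>z. F z / G z) U"
  unfolding divide_inverse
  by (intro holomorphic_several_mult holomorphic_several_inverse assms)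

lemma holomorphic_several_diff:
  assumes "holomorphic_several F U" "holomorphic_several G U"
  shows "holomorphic_several (\<lambda>z. F z - G z) U"
  using holomorphic_several_add[OF assms(1) holomorphic_several_mult[OF holomorphic_several_const[of "-1"] assms(2)]]
  by simp

lemma holomorphic_several_compose_components:
  fixes F :: "complex^'m \<Rightarrow> complex" and s :: "'m \<Rightarrow> 'n::finite"
  assumes "holomorphic_several F V" "\<And>z. z \<in> U \<Longrightarrow> (\<chi> j. z $ s j) \<in> V"
  shows "holomorphic_several (\<lambda>z. F (\<chi> j. z $ s j)) U"
proof (rule holomorphic_severalI)
  fix z assume z: "z \<in> U"
  obtain D where D: "(F has_derivative D) (at (\<chi> j. z $ s j))" "\<And>k h. D (k *s h) = k * D h"
    using holomorphic_several_homogeneous_derivative[OF assms(1) assms(2)[OF z]] by blast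
  have "bounded_linear (\<lambda>z. (\<chi> j. z $ s j) :: complex^'m)"
    by (rule linear_conv_bounded_linear[THEN iffD1], rule linearI) (auto simp: vec_eq_iff)
  from has_derivative_compose[OF bounded_linear_imp_has_derivative[OF this] D(1)]
  have "((\<lambda>z. F (\<chi> j. z $ s j)) has_derivative (\<lambda>h. D (\<chi> j. h $ s j))) (at z)" .
  moreover have "D (\<chi> j. (k *s h) $ s j) = k * D (\<chi> j. h $ s j)" for k h
  proof -
    have "(\<chi> j. (k *s h) $ s j) = k *s (\<chi> j. h $ s j)" by (simp add: vec_eq_iff)
    then show ?thesis by (simp add: D)
  qed
  ultimately show "\<exists>D. ((\<lambda>z. F (\<chi> j. z $ s j)) has_derivative D) (at z) \<and> (\<forall>k h. D (k *s h) = k * D h)"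
    by blast
qed

lemma pd_cong:
  assumes "open U" "holomorphic_several F U" "\<And>z. z \<in> U \<Longrightarrow> F z = G z" "z \<in> U"
  shows "pd i G z = pd i F z"
proof -
  have "(G has_derivative (\<lambda>h. \<Sum>j\<in>UNIV. (\<chi> j. pd j F z) $ j * h $ j)) (at z)"
    by (rule has_derivative_transform_within_open[OF _ assms(1,4,3)])
      (use has_derivative_pd[OF assms(2,4)] in simp)
  from pd_eq[OF this] show ?thesis by simp
qed

section \<open>Differentials in the contact coframe\<close>

text \<open>
  The differential of \<open>F\<close> at \<open>z\<close> is \<open>a dx + b (du - p dx) + c dp + e dq\<close>. In this coframe \<open>a\<close> is the
  part of the total derivative that comes from the base variables.
\<close>

definition cograd :: "(jet2 \<Rightarrow> complex) \<Rightarrow> jet2 \<Rightarrow> complex \<Rightarrow> complex \<Rightarrow> complex \<Rightarrow> complex \<Rightarrow> bool"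
  where "cograd F z a b c e \<longleftrightarrow>
    (F has_derivative (\<lambda>h. a * h $ 1 + b * (h $ 2 - z $ 3 * h $ 1) + c * h $ 3 + e * h $ 4)) (at z)"

definition dxu :: "(jet2 \<Rightarrow> complex) \<Rightarrow> jet2 \<Rightarrow> complex"
  where "dxu F z = pd 1 F z + z $ 3 * pd 2 F z"

lemma vector_4 [simp]:
  "(vector [a, b, c, d] :: 'a::zero^4) $ 1 = a"
  "(vector [a, b, c, d] :: 'a::zero^4) $ 2 = b"
  "(vector [a, b, c, d] :: 'a::zero^4) $ 3 = c"
  "(vector [a, b, c, d] :: 'a::zero^4) $ 4 = d"
  by (simp_all add: vector_def)

lemma cograd_pds:
  assumes "cograd F z a b c e"
  shows "dxu F z = a" "pd 2 F z = b" "pd 3 F z = c" "pd 4 F z = e" "Dhat g F z = a + z $ 4 * c + g z * e"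
proof -
  have "(F has_derivative (\<lambda>h. \<Sum>j\<in>UNIV. (vector [a - z $ 3 * b, b, c, e] :: complex^4) $ j * h $ j)) (at z)"
    using assms unfolding cograd_def by (rule has_derivative_eq_rhs) (simp add: sum_4 fun_eq_iff algebra_simps)
  note pd = pd_eq[OF this]
  show "dxu F z = a" "pd 2 F z = b" "pd 3 F z = c" "pd 4 F z = e" "Dhat g F z = a + z $ 4 * c + g z * e"
    by (simp_all add: dxu_def Dhat_def pd algebra_simps)
qed

lemma cograd_holomorphic:
  assumes "holomorphic_several F U" "z \<in> U"
  shows "cograd F z (dxu F z) (pd 2 F z) (pd 3 F z) (pd 4 F z)"
  using has_derivative_pd[OF assms] unfolding cograd_def
  by (rule has_derivative_eq_rhs) (simp add: sum_4 fun_eq_iff algebra_simps dxu_def)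

lemma cograd_imp_holomorphic:
  assumes "\<And>z. z \<in> U \<Longrightarrow> \<exists>a b c e. cograd F z a b c e"
  shows "holomorphic_several F U"
proof (rule holomorphic_severalI)
  fix z assume "z \<in> U"
  then obtain a b c e where "cograd F z a b c e" using assms by blast
  then show "\<exists>D. (F has_derivative D) (at z) \<and> (\<forall>k h. D (k *s h) = k * D h)"
    unfolding cograd_def by (intro exI conjI) (auto simp: algebra_simps)
qed

lemma cograd_transform:
  assumes "cograd F z a b c e" "open U" "z \<in> U" "\<And>z. z \<in> U \<Longrightarrow> F z = G z"
  shows "cograd G z a b c e"
  using assms(1) unfolding cograd_def
  by (rule has_derivative_transform_within_open[OF _ assms(2,3)]) (rule assms)

lemma cograd_eq:
  "cograd F z a' b' c' e' \<Longrightarrow> a' = a \<Longrightarrow> b' = b \<Longrightarrow> c' = c \<Longrightarrow> e' = e \<Longrightarrow> cograd F z a b c e"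
  by simp

named_theorems cograd_intros

lemma cograd_const [cograd_intros]: "cograd (\<lambda>_. k) z 0 0 0 0"
  unfolding cograd_def by (rule has_derivative_eq_rhs[OF has_derivative_const]) simp

lemma cograd_q [cograd_intros]: "cograd (\<lambda>z. z $ 4) z 0 0 0 1"
  unfolding cograd_def
  by (rule has_derivative_eq_rhs[OF bounded_linear_imp_has_derivative[OF bounded_linear_vec_nth]]) simp

lemma cograd_add [cograd_intros]:
  assumes "cograd F z a b c e" "cograd G z a' b' c' e'"
  shows "cograd (\<lambda>z. F z + G z) z (a + a') (b + b') (c + c') (e + e')"
  using assms unfolding cograd_def
  by (rule has_derivative_eq_rhs[OF has_derivative_add]) (simp add: fun_eq_iff algebra_simps)

lemma cograd_diff [cograd_intros]:
  assumes "cograd F z a b c e" "cograd G z a' b' c' e'"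
  shows "cograd (\<lambda>z. F z - G z) z (a - a') (b - b') (c - c') (e - e')"
  using assms unfolding cograd_def
  by (rule has_derivative_eq_rhs[OF has_derivative_diff]) (simp add: fun_eq_iff algebra_simps)

lemma cograd_minus [cograd_intros]:
  assumes "cograd F z a b c e"
  shows "cograd (\<lambda>z. - F z) z (- a) (- b) (- c) (- e)"
  using assms unfolding cograd_def
  by (rule has_derivative_eq_rhs[OF has_derivative_minus]) (simp add: fun_eq_iff algebra_simps)

lemma cograd_mult [cograd_intros]:
  assumes "cograd F z a b c e" "cograd G z a' b' c' e'"
  shows "cograd (\<lambda>z. F z * G z) z (a * G z + F z * a') (b * G z + F z * b')
    (c * G z + F z * c') (e * G z + F z * e')"
  using assms unfolding cograd_def
  by (rule has_derivative_eq_rhs[OF has_derivative_mult]) (simp add: fun_eq_iff algebra_simps)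

lemma cograd_power2 [cograd_intros]:
  assumes "cograd F z a b c e"
  shows "cograd (\<lambda>z. (F z)\<^sup>2) z (2 * F z * a) (2 * F z * b) (2 * F z * c) (2 * F z * e)"
  unfolding power2_eq_square
  by (rule cograd_eq[OF cograd_mult[OF assms assms]]) (simp_all add: algebra_simps)

lemma cograd_divide [cograd_intros]:
  assumes "cograd F z a b c e" "cograd G z a' b' c' e'" "G z \<noteq> 0"
  shows "cograd (\<lambda>z. F z / G z) z ((a - F z / G z * a') / G z) ((b - F z / G z * b') / G z)
    ((c - F z / G z * c') / G z) ((e - F z / G z * e') / G z)"
  using assms(1,2) unfolding cograd_def
  by (rule has_derivative_eq_rhs[OF has_derivative_divide'])
     (use assms(3) in \<open>simp_all add: fun_eq_iff field_simps\<close>)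

lemma cograd_divide_numeral:
  assumes "cograd F z a b c e"
  shows "cograd (\<lambda>z. F z / numeral n) z (a / numeral n) (b / numeral n) (c / numeral n) (e / numeral n)"
  using cograd_mult[OF assms cograd_const[of "inverse (numeral n)"]]
  by (simp only: divide_inverse mult_zero_right add_0_right)

lemma holomorphic_dxu:
  assumes "holomorphic_several F U" "open U"
  shows "holomorphic_several (dxu F) U"
  unfolding dxu_def[abs_def]
  by (intro holomorphic_several_add holomorphic_several_mult holomorphic_several_pd
    holomorphic_several_component assms)

text \<open>
  The coefficients are those of \<open>d\<close> applied to the derivatives of \<open>F\<close>, except for the term \<open>pd 2 F\<close>,
  which is the commutator of \<open>\<partial>\<^sub>p\<close> with \<open>\<partial>\<^sub>x + p \<partial>\<^sub>u\<close>.
\<close>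

lemma cograd_dxu:
  assumes F: "holomorphic_several F U" and U: "open U" and z: "z \<in> U"
  shows "cograd (dxu F) z (dxu (dxu F) z) (dxu (pd 2 F) z) (dxu (pd 3 F) z + pd 2 F z) (dxu (pd 4 F) z)"
proof -
  have 1: "cograd (pd i F) z (dxu (pd i F) z) (pd 2 (pd i F) z) (pd 3 (pd i F) z) (pd 4 (pd i F) z)" for i
    by (rule cograd_holomorphic[OF holomorphic_several_pd[OF F U] z])
  have p: "cograd (\<lambda>z. z $ 3) z 0 0 1 0"
    unfolding cograd_def
    by (rule has_derivative_eq_rhs[OF bounded_linear_imp_has_derivative[OF bounded_linear_vec_nth]]) simp
  note 2 = cograd_add[OF 1[of 1] cograd_mult[OF p 1[of 2]], folded dxu_def]
  have "cograd (dxu F) z (dxu (dxu F) z) (pd 2 (dxu F) z) (pd 3 (dxu F) z) (pd 4 (dxu F) z)"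
    by (rule cograd_holomorphic[OF holomorphic_dxu[OF F U] z])
  then show ?thesis
    unfolding cograd_pds(2-4)[OF 2]
    by (rule cograd_eq) (simp_all add: dxu_def pd_commute[OF F U z])
qed

lemma cograd_pd2:
  assumes F: "holomorphic_several F U" and U: "open U" and z: "z \<in> U"
  shows "cograd (pd 2 F) z (pd 2 (dxu F) z) (pd 2 (pd 2 F) z) (pd 2 (pd 3 F) z) (pd 2 (pd 4 F) z)"
  by (rule cograd_eq[OF cograd_holomorphic[OF holomorphic_several_pd[OF F U] z]])
    (simp_all add: pd_commute[OF F U z, of 3 2] pd_commute[OF F U z, of 4 2] cograd_pds(2)[OF cograd_dxu[OF F U z]])

lemma pd_eq_0_on:
  assumes "open U" "z \<in> U" "\<And>z. z \<in> U \<Longrightarrow> F z = 0"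
  shows "pd i F z = 0" "dxu F z = 0"
proof -
  have "cograd F z 0 0 0 0"
    by (rule cograd_transform[OF cograd_const assms(1,2)]) (simp add: assms)
  then show "dxu F z = 0" by (simp add: cograd_pds)
  have "pd i F z = pd i (\<lambda>_. 0) z" for i
    by (rule pd_cong[OF assms(1) holomorphic_several_const _ assms(2)]) (simp add: assms)
  then show "pd i F z = 0" by (simp add: pd_def)
qed

section \<open>The matrices of the determining system\<close>

lemma vector_6 [simp]:
  "(vector [a, b, c, d, e, g] :: 'a::zero^6) $ 1 = a"
  "(vector [a, b, c, d, e, g] :: 'a::zero^6) $ 2 = b"
  "(vector [a, b, c, d, e, g] :: 'a::zero^6) $ 3 = c"
  "(vector [a, b, c, d, e, g] :: 'a::zero^6) $ 4 = d"
  "(vector [a, b, c, d, e, g] :: 'a::zero^6) $ 5 = e"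
  "(vector [a, b, c, d, e, g] :: 'a::zero^6) $ 6 = g"
  by (simp_all add: vector_def)

lemma exhaust_6:
  fixes x :: 6
  shows "x = 1 \<or> x = 2 \<or> x = 3 \<or> x = 4 \<or> x = 5 \<or> x = 6"
proof (induct x)
  case (of_int z)
  then have "z = 0 \<or> z = 1 \<or> z = 2 \<or> z = 3 \<or> z = 4 \<or> z = 5" by fastforce
  then show ?case by auto
qed

lemma forall_6: "(\<forall>i::6. P i) \<longleftrightarrow> P 1 \<and> P 2 \<and> P 3 \<and> P 4 \<and> P 5 \<and> P 6"
  by (metis exhaust_6)

lemma sum_6: "sum h (UNIV :: 6 set) = h 1 + h 2 + h 3 + h 4 + h 5 + h 6"
proof -
  have U: "UNIV = {1, 2, 3, 4, 5, 6 :: 6}" using exhaust_6 by auto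
  show ?thesis unfolding U by (simp add: ac_simps)
qed

lemma matrix_inv_eq:
  fixes A B :: "complex^'n^'n"
  assumes "A ** B = mat 1"
  shows "matrix_inv A = B"
proof -
  have "B ** A = mat 1" using assms matrix_left_right_inverse by blast
  with assms have inv: "matrix_inv A ** A = mat 1"
    unfolding matrix_inv_def
    using someI[of "\<lambda>X. A ** X = mat 1 \<and> X ** A = mat 1" B] by blast
  have "matrix_inv A = matrix_inv A ** (A ** B)" by (simp add: assms)
  also have "\<dots> = B" by (simp add: matrix_mul_assoc inv)
  finally show ?thesis .
qed

text \<open>
  The rows are obtained by forward substitution, as the matrix is lower triangular.
\<close>

definition Mmat_inverse :: "complex \<Rightarrow> complex \<Rightarrow> complex^6^6"
  where "Mmat_inverse \<xi> \<eta> = vector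
    [vector [1, 0, 0, 0, 0, 0],
     vector [0, 2 * \<xi>, 0, 0, 0, 0],
     vector [0, 2 * \<eta>, 4 * \<xi>^2, 0, 0, 0],
     vector [- (1 / (2 * \<xi>)), 0, 0, 1 / (2 * \<xi>), 0, 0],
     vector [0, - 1, 0, 0, 1, 0],
     vector [0, 0, - 1, 0, 0, 1]]"

lemma Mmat_Mmat_inverse: "\<xi> \<noteq> 0 \<Longrightarrow> Mmat \<xi> \<eta> ** Mmat_inverse \<xi> \<eta> = mat 1"
  by (simp add: vec_eq_iff forall_6 Mmat_def Mmat_inverse_def matrix_matrix_mult_def mat_def sum_6
      power2_eq_square power3_eq_cube)

text \<open>
  The coefficients \<open>b\<^sub>1, \<dots>, b\<^sub>1\<^sub>7\<close> are numbered from one, so the list starts with a dummy entry.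
\<close>

definition bcoeff :: "(jet2 \<Rightarrow> complex) \<Rightarrow> complex \<Rightarrow> complex \<Rightarrow> complex \<Rightarrow> complex \<Rightarrow> complex \<Rightarrow> jet2 \<Rightarrow> nat \<Rightarrow> complex"
  where "bcoeff f J a\<^sub>1 a\<^sub>2 \<xi> \<eta> z i =
  [0, a\<^sub>1, 2 * \<xi> * a\<^sub>2, 2 * \<xi> * J,
   2 * \<eta> * a\<^sub>2 + 4 * \<xi>\<^sup>2 * (a\<^sub>2^2 / (2 * a\<^sub>1) + J^2 / (2 * a\<^sub>1) * I2 f z),
   2 * \<eta> * J + 4 * \<xi>\<^sup>2 * (a\<^sub>2 * J / a\<^sub>1 + J^2 / (3 * a\<^sub>1) * I1 f z),
   4 * \<xi>\<^sup>2 * (J^2 / a\<^sub>1),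
   (a\<^sub>1 / J * I3 f z - a\<^sub>1) / (2 * \<xi>),
   a\<^sub>1 / J / (2 * \<xi>),
   I8 f J a\<^sub>2 z - a\<^sub>2,
   I3 f z - J,
   - a\<^sub>2 / J,
   1 / a\<^sub>1,
   I9 f J a\<^sub>1 a\<^sub>2 z - (a\<^sub>2^2 / (2 * a\<^sub>1) + J^2 / (2 * a\<^sub>1) * I2 f z),
   I10 f J a\<^sub>1 a\<^sub>2 z - (a\<^sub>2 * J / a\<^sub>1 + J^2 / (3 * a\<^sub>1) * I1 f z),
   I3 f z * J / a\<^sub>1 - J^2 / a\<^sub>1,
   - (1 / (2 * a\<^sub>1)) * (I2 f z * J + a\<^sub>2^2 / J),
   1 / a\<^sub>1] ! i"

lemma Bmat_bcoeff:
  assumes "\<xi> \<noteq> 0"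
  shows "Bmat (bcoeff f J a\<^sub>1 a\<^sub>2 \<xi> \<eta> z) = matrix_inv (Mmat \<xi> \<eta>) ** Nmat f J a\<^sub>1 a\<^sub>2 z"
  unfolding matrix_inv_eq[OF Mmat_Mmat_inverse[OF assms]]
  by (simp add: vec_eq_iff forall_6 matrix_matrix_mult_def sum_6 Bmat_def Nmat_def Mmat_inverse_def bcoeff_def
     diff_divide_distrib)

section \<open>Jets of a function of the base variables\<close>

text \<open>
  The jets of \<open>\<Phi>\<close> divided by \<open>P = dxu \<Phi>\<close>. The suffixes name the derivatives of \<open>\<Phi>\<close> that are taken, with
  \<open>d\<close> for \<open>dxu\<close>. Thus \<open>jet_u\<close>, \<open>jet_dd\<close>, \<open>jet_ud\<close> are the logarithmic derivatives of \<open>P\<close> by \<open>\<partial>\<^sub>p\<close>, \<open>d\<close>, \<open>\<partial>\<^sub>u\<close>.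

  The function \<open>schwarz_dd\<close> is the Schwarzian derivative of \<open>\<Phi>\<close> along \<open>d\<close>. Its derivative by \<open>p\<close>, up to a
  multiple of itself, is three times \<open>schwarz_ud\<close>, and the derivative of \<open>schwarz_ud\<close> gives \<open>schwarz_uu\<close> in the
  same way (lemmas \<open>cograd_schwarz_dd\<close> and \<open>cograd_schwarz_ud\<close>).
\<close>

definition jet_u where "jet_u \<Phi> z = pd 2 \<Phi> z / dxu \<Phi> z"
definition jet_dd where "jet_dd \<Phi> z = dxu (dxu \<Phi>) z / dxu \<Phi> z"
definition jet_ud where "jet_ud \<Phi> z = pd 2 (dxu \<Phi>) z / dxu \<Phi> z"
definition jet_uu where "jet_uu \<Phi> z = pd 2 (pd 2 \<Phi>) z / dxu \<Phi> z"
definition schwarz_dd where "schwarz_dd \<Phi> z = dxu (jet_dd \<Phi>) z - (jet_dd \<Phi> z)\<^sup>2 / 2"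
definition schwarz_ud where "schwarz_ud \<Phi> z = pd 2 (jet_dd \<Phi>) z - jet_ud \<Phi> z * jet_dd \<Phi> z + jet_u \<Phi> z * (jet_dd \<Phi> z)\<^sup>2 / 2"
definition schwarz_uu where "schwarz_uu \<Phi> z = pd 2 (jet_ud \<Phi>) z - (jet_ud \<Phi> z)\<^sup>2 - jet_uu \<Phi> z * jet_dd \<Phi> z
  + 2 * jet_u \<Phi> z * jet_ud \<Phi> z * jet_dd \<Phi> z - (jet_u \<Phi> z)\<^sup>2 * (jet_dd \<Phi> z)\<^sup>2 / 2"

text \<open>
  The lift of a function of \<open>x\<close> and \<open>u\<close> to the jet space, with nonvanishing total derivative.
\<close>

locale base_function =
  fixes U :: "jet2 set" and \<Phi> :: "jet2 \<Rightarrow> complex"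
  assumes open_U: "open U"
    and holomorphic: "holomorphic_several \<Phi> U"
    and pd_0: "z \<in> U \<Longrightarrow> pd 3 \<Phi> z = 0" "z \<in> U \<Longrightarrow> pd 4 \<Phi> z = 0"
    and nonzero: "z \<in> U \<Longrightarrow> dxu \<Phi> z \<noteq> 0"
begin

lemma cograd_on_U:
  assumes z: "z \<in> U" and eq: "\<And>z. z \<in> U \<Longrightarrow> F z = G z" and G: "cograd G z a b c e"
  shows "cograd F z a b c e"
  by (rule cograd_transform[OF G open_U z]) (simp add: eq)

context
  fixes z assumes z: "z \<in> U"
begin

lemma cograd_base: "cograd \<Phi> z (dxu \<Phi> z) (jet_u \<Phi> z * dxu \<Phi> z) 0 0"
  by (rule cograd_eq[OF cograd_holomorphic[OF holomorphic z]])
    (use nonzero z in \<open>auto simp: pd_0 jet_u_def\<close>)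

lemma cograd_d: "cograd (dxu \<Phi>) z (jet_dd \<Phi> z * dxu \<Phi> z) (jet_ud \<Phi> z * dxu \<Phi> z) (jet_u \<Phi> z * dxu \<Phi> z) 0"
proof -
  note 1 = cograd_dxu[OF holomorphic open_U z]
  show ?thesis
    by (rule cograd_eq[OF 1])
      (use nonzero z pd_eq_0_on[OF open_U z pd_0(1)] pd_eq_0_on[OF open_U z pd_0(2)] in
        \<open>auto simp: jet_dd_def jet_ud_def jet_u_def cograd_pds(2)[OF 1]\<close>)
qed

lemma cograd_u: "cograd (pd 2 \<Phi>) z (jet_ud \<Phi> z * dxu \<Phi> z) (jet_uu \<Phi> z * dxu \<Phi> z) 0 0"
  by (rule cograd_eq[OF cograd_pd2[OF holomorphic open_U z]])
      (use nonzero z pd_eq_0_on[OF open_U z pd_0(1)] pd_eq_0_on[OF open_U z pd_0(2)] in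
        \<open>auto simp: jet_ud_def jet_uu_def\<close>)

end

lemma holomorphic_d: "holomorphic_several (dxu \<Phi>) U"
  by (rule holomorphic_dxu[OF holomorphic open_U])

lemma holomorphic_u: "holomorphic_several (pd 2 \<Phi>) U"
  by (rule holomorphic_several_pd[OF holomorphic open_U])

context
  fixes z assumes z: "z \<in> U"
begin

text \<open>
  Only the derivatives by \<open>p\<close> and \<open>q\<close> can be reduced to lower jets. The other two coefficients are jets
  of higher order and remain unnamed.
\<close>

lemma cograd_dd:
  obtains a b where "cograd (dxu (dxu \<Phi>)) z a b (2 * jet_ud \<Phi> z * dxu \<Phi> z) 0"
proof -
  have 3: "dxu (pd 3 (dxu \<Phi>)) z = jet_ud \<Phi> z * dxu \<Phi> z"
    by (rule cograd_pds(1)[OF cograd_on_U[OF z _ cograd_u[OF z]]])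
      (use nonzero in \<open>simp add: cograd_pds(3)[OF cograd_d] jet_u_def\<close>)
  have 4: "dxu (pd 4 (dxu \<Phi>)) z = 0"
    by (rule pd_eq_0_on[OF open_U z]) (simp add: cograd_pds(4)[OF cograd_d])
  from cograd_dxu[OF holomorphic_d open_U z] show thesis
    by (rule that[OF cograd_eq[OF _ refl refl]])
      (simp_all add: 3 4 cograd_pds(2)[OF cograd_d[OF z]])
qed

lemma cograd_ud:
  obtains a b where "cograd (pd 2 (dxu \<Phi>)) z a b (jet_uu \<Phi> z * dxu \<Phi> z) 0"
proof -
  have 3: "pd 2 (pd 3 (dxu \<Phi>)) z = jet_uu \<Phi> z * dxu \<Phi> z"
    by (rule cograd_pds(2)[OF cograd_on_U[OF z _ cograd_u[OF z]]])
      (use nonzero in \<open>simp add: cograd_pds(3)[OF cograd_d] jet_u_def\<close>)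
  have 4: "pd 2 (pd 4 (dxu \<Phi>)) z = 0"
    by (rule pd_eq_0_on[OF open_U z]) (simp add: cograd_pds(4)[OF cograd_d])
  from cograd_pd2[OF holomorphic_d open_U z] show thesis
    by (rule that[OF cograd_eq[OF _ refl refl]]) (simp_all add: 3 4)
qed

lemma cograd_uu:
  obtains a b where "cograd (pd 2 (pd 2 \<Phi>)) z a b 0 0"
proof -
  have "pd 2 (pd 3 (pd 2 \<Phi>)) z = 0" "pd 2 (pd 4 (pd 2 \<Phi>)) z = 0"
    by (rule pd_eq_0_on[OF open_U z], simp add: cograd_pds(3,4)[OF cograd_u])+
  then show thesis
    by (intro that[OF cograd_eq[OF cograd_pd2[OF holomorphic_u open_U z] refl refl]])
qed

lemma cograd_jet_u:
  "cograd (jet_u \<Phi>) z (jet_ud \<Phi> z - jet_u \<Phi> z * jet_dd \<Phi> z) (jet_uu \<Phi> z - jet_u \<Phi> z * jet_ud \<Phi> z) (- (jet_u \<Phi> z)\<^sup>2) 0"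
  using cograd_divide[OF cograd_u[OF z] cograd_d[OF z] nonzero[OF z], folded jet_u_def]
  by (rule cograd_eq) (use nonzero[OF z] in \<open>simp_all add: field_simps power2_eq_square\<close>)

lemma cograd_jet_uu: "cograd (jet_uu \<Phi>) z (dxu (jet_uu \<Phi>) z) (pd 2 (jet_uu \<Phi>) z) (- jet_uu \<Phi> z * jet_u \<Phi> z) 0"
proof -
  obtain a b where "cograd (pd 2 (pd 2 \<Phi>)) z a b 0 0" by (rule cograd_uu)
  note 1 = cograd_divide[OF this cograd_d[OF z] nonzero[OF z], folded jet_uu_def]
  show ?thesis
    by (rule cograd_eq[OF 1])
      (use nonzero[OF z] in \<open>simp_all add: cograd_pds(1,2)[OF 1]\<close>)
qed

lemma cograd_jet_dd_aux:
  "cograd (jet_dd \<Phi>) z (dxu (jet_dd \<Phi>) z) (pd 2 (jet_dd \<Phi>) z) (2 * jet_ud \<Phi> z - jet_u \<Phi> z * jet_dd \<Phi> z) 0"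
proof -
  obtain a b where "cograd (dxu (dxu \<Phi>)) z a b (2 * jet_ud \<Phi> z * dxu \<Phi> z) 0" by (rule cograd_dd)
  note 1 = cograd_divide[OF this cograd_d[OF z] nonzero[OF z], folded jet_dd_def]
  show ?thesis
    by (rule cograd_eq[OF 1])
      (use nonzero[OF z] in \<open>simp_all add: cograd_pds(1,2)[OF 1] field_simps\<close>)
qed

lemma cograd_jet_dd:
  "cograd (jet_dd \<Phi>) z (schwarz_dd \<Phi> z + (jet_dd \<Phi> z)\<^sup>2 / 2)
    (schwarz_ud \<Phi> z + jet_ud \<Phi> z * jet_dd \<Phi> z - jet_u \<Phi> z * (jet_dd \<Phi> z)\<^sup>2 / 2) (2 * jet_ud \<Phi> z - jet_u \<Phi> z * jet_dd \<Phi> z) 0"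
  by (rule cograd_eq[OF cograd_jet_dd_aux]) (simp_all add: schwarz_dd_def schwarz_ud_def)

lemma cograd_jet_ud_aux:
  "cograd (jet_ud \<Phi>) z (dxu (jet_ud \<Phi>) z) (pd 2 (jet_ud \<Phi>) z) (jet_uu \<Phi> z - jet_ud \<Phi> z * jet_u \<Phi> z) 0"
proof -
  obtain a b where "cograd (pd 2 (dxu \<Phi>)) z a b (jet_uu \<Phi> z * dxu \<Phi> z) 0" by (rule cograd_ud)
  note 1 = cograd_divide[OF this cograd_d[OF z] nonzero[OF z], folded jet_ud_def]
  show ?thesis
    by (rule cograd_eq[OF 1])
      (use nonzero[OF z] in \<open>simp_all add: cograd_pds(1,2)[OF 1] field_simps\<close>)
qed

text \<open>
  Both sides are mixed second derivatives, by \<open>d\<close> and \<open>\<partial>\<^sub>u\<close>, of the logarithm of \<open>P\<close>.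
\<close>

lemma dxu_jet_ud: "dxu (jet_ud \<Phi>) z = pd 2 (jet_dd \<Phi>) z"
proof -
  have "cograd (pd 2 (dxu \<Phi>)) z (pd 2 (dxu (dxu \<Phi>)) z) (pd 2 (pd 2 (dxu \<Phi>)) z)
      (pd 2 (pd 3 (dxu \<Phi>)) z) (pd 2 (pd 4 (dxu \<Phi>)) z)"
    by (rule cograd_pd2[OF holomorphic_d open_U z])
  note 1 = cograd_divide[OF this cograd_d[OF z] nonzero[OF z], folded jet_ud_def]
  have "cograd (dxu (dxu \<Phi>)) z (dxu (dxu (dxu \<Phi>)) z) (pd 2 (dxu (dxu \<Phi>)) z)
      (pd 3 (dxu (dxu \<Phi>)) z) (pd 4 (dxu (dxu \<Phi>)) z)"
    by (rule cograd_holomorphic[OF holomorphic_dxu[OF holomorphic_d open_U] z])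
  note 2 = cograd_divide[OF this cograd_d[OF z] nonzero[OF z], folded jet_dd_def]
  show ?thesis
    unfolding cograd_pds(1)[OF 1] cograd_pds(2)[OF 2] by simp
qed

lemma cograd_jet_ud:
  "cograd (jet_ud \<Phi>) z (schwarz_ud \<Phi> z + jet_ud \<Phi> z * jet_dd \<Phi> z - jet_u \<Phi> z * (jet_dd \<Phi> z)\<^sup>2 / 2)
    (schwarz_uu \<Phi> z + (jet_ud \<Phi> z)\<^sup>2 + jet_uu \<Phi> z * jet_dd \<Phi> z - 2 * jet_u \<Phi> z * jet_ud \<Phi> z * jet_dd \<Phi> z
      + (jet_u \<Phi> z)\<^sup>2 * (jet_dd \<Phi> z)\<^sup>2 / 2)
    (jet_uu \<Phi> z - jet_ud \<Phi> z * jet_u \<Phi> z) 0"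
  by (rule cograd_eq[OF cograd_jet_ud_aux]) (simp_all add: dxu_jet_ud schwarz_ud_def schwarz_uu_def)

end

lemma holomorphic_jet_dd: "holomorphic_several (jet_dd \<Phi>) U"
  by (rule cograd_imp_holomorphic) (use cograd_jet_dd in blast)

context
  fixes z assumes z: "z \<in> U"
begin

text \<open>
  The third order jets are first derivatives of \<open>jet_dd\<close>, so their derivatives by \<open>p\<close> are, up to the
  commutator, derivatives of \<open>\<partial>\<^sub>p jet_dd\<close>. The latter is a polynomial in jets of order at most two.
\<close>

lemma cograd_pd3_jet_dd:
  "cograd (pd 3 (jet_dd \<Phi>)) z
   (2 * (schwarz_ud \<Phi> z + jet_ud \<Phi> z * jet_dd \<Phi> z - jet_u \<Phi> z * (jet_dd \<Phi> z)\<^sup>2 / 2)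
     - (jet_ud \<Phi> z - jet_u \<Phi> z * jet_dd \<Phi> z) * jet_dd \<Phi> z - jet_u \<Phi> z * (schwarz_dd \<Phi> z + (jet_dd \<Phi> z)\<^sup>2 / 2))
   (2 * (schwarz_uu \<Phi> z + (jet_ud \<Phi> z)\<^sup>2 + jet_uu \<Phi> z * jet_dd \<Phi> z - 2 * jet_u \<Phi> z * jet_ud \<Phi> z * jet_dd \<Phi> z
      + (jet_u \<Phi> z)\<^sup>2 * (jet_dd \<Phi> z)\<^sup>2 / 2) - (jet_uu \<Phi> z - jet_u \<Phi> z * jet_ud \<Phi> z) * jet_dd \<Phi> z
      - jet_u \<Phi> z * (schwarz_ud \<Phi> z + jet_ud \<Phi> z * jet_dd \<Phi> z - jet_u \<Phi> z * (jet_dd \<Phi> z)\<^sup>2 / 2))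
   (2 * (jet_uu \<Phi> z - jet_ud \<Phi> z * jet_u \<Phi> z) + (jet_u \<Phi> z)\<^sup>2 * jet_dd \<Phi> z - jet_u \<Phi> z * (2 * jet_ud \<Phi> z - jet_u \<Phi> z * jet_dd \<Phi> z)) 0"
  by (rule cograd_on_U[OF z cograd_pds(3)[OF cograd_jet_dd]],
      assumption, rule cograd_eq, (rule cograd_divide_numeral cograd_intros cograd_jet_ud[OF z] cograd_jet_u[OF z] cograd_jet_dd[OF z])+)
    simp_all

lemma cograd_schwarz_dd: "cograd (schwarz_dd \<Phi>) z (dxu (schwarz_dd \<Phi>) z) (pd 2 (schwarz_dd \<Phi>) z) (3 * schwarz_ud \<Phi> z - jet_u \<Phi> z * schwarz_dd \<Phi> z) 0"
proof -
  have 4: "dxu (pd 4 (jet_dd \<Phi>)) z = 0"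
    by (rule pd_eq_0_on[OF open_U z]) (simp add: cograd_pds(4)[OF cograd_jet_dd])
  have 2: "cograd (\<lambda>z. 2) z 0 0 0 0" by (rule cograd_const)
  have 1: "cograd (\<lambda>z. dxu (jet_dd \<Phi>) z - (jet_dd \<Phi> z)\<^sup>2 / 2) z
      (dxu (dxu (jet_dd \<Phi>)) z - jet_dd \<Phi> z * dxu (jet_dd \<Phi>) z)
      (dxu (pd 2 (jet_dd \<Phi>)) z - jet_dd \<Phi> z * pd 2 (jet_dd \<Phi>) z)
      (dxu (pd 3 (jet_dd \<Phi>)) z + pd 2 (jet_dd \<Phi>) z - jet_dd \<Phi> z * (2 * jet_ud \<Phi> z - jet_u \<Phi> z * jet_dd \<Phi> z)) (dxu (pd 4 (jet_dd \<Phi>)) z)"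
    by (rule cograd_eq[OF cograd_diff[OF cograd_dxu[OF holomorphic_jet_dd open_U z]
      cograd_divide[OF cograd_power2[OF cograd_jet_dd_aux[OF z]] 2]]]) simp_all
  show ?thesis
    by (rule cograd_eq[OF 1[folded schwarz_dd_def]])
      (simp_all add: 4 cograd_pds(1,2)[OF 1[folded schwarz_dd_def]] cograd_pds(1)[OF cograd_pd3_jet_dd]
        cograd_pds(2)[OF cograd_jet_dd[OF z]] algebra_simps power2_eq_square)
qed

lemma cograd_schwarz_ud: "cograd (schwarz_ud \<Phi>) z (dxu (schwarz_ud \<Phi>) z) (pd 2 (schwarz_ud \<Phi>) z) (2 * schwarz_uu \<Phi> z - jet_u \<Phi> z * schwarz_ud \<Phi> z) 0"
proof -
  have 4: "pd 2 (pd 4 (jet_dd \<Phi>)) z = 0"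
    by (rule pd_eq_0_on[OF open_U z]) (simp add: cograd_pds(4)[OF cograd_jet_dd])
  have "\<exists>a b c e. cograd (schwarz_ud \<Phi>) z a b c e \<and> c = 2 * schwarz_uu \<Phi> z - jet_u \<Phi> z * schwarz_ud \<Phi> z \<and> e = 0"
    unfolding schwarz_ud_def[abs_def]
    apply (intro exI conjI)
      apply (rule cograd_divide_numeral cograd_intros cograd_jet_ud[OF z] cograd_jet_u[OF z] cograd_jet_dd[OF z]
        cograd_pd2[OF holomorphic_jet_dd open_U z])+
      apply simp
     apply (simp_all add: 4 cograd_pds(2)[OF cograd_pd3_jet_dd] cograd_pds(2)[OF cograd_jet_dd[OF z]])
    apply (simp add: field_simps power2_eq_square)
    done
  then obtain a b where 1: "cograd (schwarz_ud \<Phi>) z a b (2 * schwarz_uu \<Phi> z - jet_u \<Phi> z * schwarz_ud \<Phi> z) 0" by blast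
  show ?thesis by (rule cograd_eq[OF 1]) (simp_all add: cograd_pds(1,2)[OF 1])
qed

end

end

section \<open>The pullback of the Schwarzian equation\<close>

text \<open>
  The independence condition is the nonvanishing of \<open>\<Delta>\<close>, since \<open>\<psi>\<^sub>u / Q - \<phi>\<^sub>u / P = \<Delta> / (P Q)\<close>.
\<close>

locale base_pair = phi: base_function U \<Phi> + psi: base_function U \<Psi> for U \<Phi> \<Psi> +
  assumes independent: "z \<in> U \<Longrightarrow> jet_u \<Psi> z \<noteq> jet_u \<Phi> z"
begin

abbreviation "\<alpha> \<equiv> jet_u \<Phi>"
abbreviation "\<beta> \<equiv> jet_u \<Psi>"
abbreviation "S \<equiv> jet_dd \<Phi>"
abbreviation "T \<equiv> jet_dd \<Psi>"
abbreviation "m \<equiv> jet_ud \<Phi>"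
abbreviation "n \<equiv> jet_ud \<Psi>"
abbreviation "k \<equiv> jet_uu \<Phi>"
abbreviation "l \<equiv> jet_uu \<Psi>"
abbreviation "K \<equiv> schwarz_dd \<Phi>"
abbreviation "K' \<equiv> schwarz_dd \<Psi>"
abbreviation "A \<equiv> schwarz_ud \<Phi>"
abbreviation "A' \<equiv> schwarz_ud \<Psi>"
abbreviation "C \<equiv> schwarz_uu \<Phi>"
abbreviation "C' \<equiv> schwarz_uu \<Psi>"

text \<open>
  \<open>W = \<Delta> / (P Q)\<close>, with logarithmic derivatives \<open>dlogW\<close> by \<open>d\<close> and \<open>ulogW\<close> by \<open>\<partial>\<^sub>u\<close>, and
  \<open>\<tau> = \<partial>\<^sub>p log (P Q)\<close>, with derivatives \<open>d\<tau>\<close> and \<open>u\<tau>\<close>. The function \<open>E\<close> is the total derivative of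
  \<open>log (Q / P)\<close>. The transformed first and second derivatives are \<open>\<Xi>\<close> and \<open>H\<close>.
\<close>

definition W where "W z = \<beta> z - \<alpha> z"
definition \<tau> where "\<tau> z = \<alpha> z + \<beta> z"
definition d\<tau> where "d\<tau> z = m z - \<alpha> z * S z + (n z - \<beta> z * T z)"
definition u\<tau> where "u\<tau> z = k z - \<alpha> z * m z + (l z - \<beta> z * n z)"
definition E where "E z = T z - S z + z $ 4 * W z"
definition dlogW where "dlogW z = (n z - m z - \<beta> z * T z + \<alpha> z * S z) / W z"
definition ulogW where "ulogW z = (l z - \<beta> z * n z - k z + \<alpha> z * m z) / W z"
definition \<Xi> where "\<Xi> z = dxu \<Psi> z / dxu \<Phi> z"
definition H where "H z = \<Xi> z * E z / dxu \<Phi> z"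
text \<open>
  The closed forms of \<open>f\<close>, \<open>f\<^sub>p\<close>, \<open>I\<^sub>1\<close>, \<open>I\<^sub>2\<close> and \<open>a\<^sub>2\<close>, as polynomials in \<open>q\<close>.
  The Schwarzian derivatives \<open>K\<close> and \<open>K'\<close> cancel in \<open>I\<^sub>2\<close>.
\<close>

definition f_form where "f_form z = 3 * \<tau> z * (z $ 4)\<^sup>2 / 2 - 3 * dlogW z * z $ 4 + (K z - K' z) / W z"
definition fp_form where "fp_form z = - (3 * ((\<alpha> z)\<^sup>2 + (\<beta> z)\<^sup>2) * (z $ 4)\<^sup>2 / 2) - 3 * (ulogW z - d\<tau> z) * z $ 4
   + (3 * (A z - A' z) + \<beta> z * K z - \<alpha> z * K' z) / W z"
definition I1_form where "I1_form z = 3 * (dlogW z - \<tau> z * z $ 4)"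
definition I2_form where "I2_form z = - (\<alpha> z * \<beta> z * (z $ 4)\<^sup>2) + (dlogW z * \<tau> z + 2 * ulogW z - d\<tau> z) * z $ 4
   - (dlogW z)\<^sup>2 - 2 * (A z - A' z) / W z"
definition a2 where "a2 z = (n z - m z - \<alpha> z * E z) / 2"

context
  fixes z assumes z: "z \<in> U"
begin

lemmas tables = phi.cograd_jet_u[OF z] phi.cograd_jet_dd[OF z] phi.cograd_jet_ud[OF z] phi.cograd_jet_uu[OF z]
  phi.cograd_schwarz_dd[OF z] phi.cograd_schwarz_ud[OF z]
  psi.cograd_jet_u[OF z] psi.cograd_jet_dd[OF z] psi.cograd_jet_ud[OF z] psi.cograd_jet_uu[OF z]
  psi.cograd_schwarz_dd[OF z] psi.cograd_schwarz_ud[OF z] cograd_divide_numeral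

lemma W_nonzero: "W z \<noteq> 0"
  using independent[OF z] by (simp add: W_def)

lemma beta_eq: "\<beta> z = \<alpha> z + W z"
  by (simp add: W_def)

text \<open>
  Eliminating \<open>n\<close> and \<open>l\<close> by the logarithmic derivatives of \<open>W\<close>, and \<open>\<beta>\<close> by \<open>W\<close> itself, leaves only
  independent quantities. The identities below then hold as identities of polynomials, once they are
  multiplied by powers of \<open>W\<close>.
\<close>

lemma n_eq: "n z = m z + dlogW z * W z + \<beta> z * T z - \<alpha> z * S z"
  using W_nonzero by (simp add: dlogW_def)

lemma l_eq: "l z = k z - \<alpha> z * m z + ulogW z * W z + \<beta> z * n z"
  using W_nonzero by (simp add: ulogW_def)

lemma cograd_W: "cograd W z (dlogW z * W z) (ulogW z * W z) (- \<tau> z * W z) 0"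
  unfolding W_def[abs_def]
  by (rule cograd_eq, (rule tables cograd_intros)+)
    (use W_nonzero in \<open>simp_all add: W_def[symmetric] dlogW_def ulogW_def \<tau>_def power2_eq_square\<close>,
     simp add: W_def algebra_simps)

lemma cograd_\<tau>: "cograd \<tau> z (d\<tau> z) (u\<tau> z) (- ((\<alpha> z)\<^sup>2 + (\<beta> z)\<^sup>2)) 0"
  unfolding \<tau>_def[abs_def]
  by (rule cograd_eq, (rule tables cograd_intros)+) (simp_all add: d\<tau>_def u\<tau>_def)

lemma cograd_d\<tau>:
  obtains a b where "cograd d\<tau> z a b (u\<tau> z - 2 * \<alpha> z * (m z - \<alpha> z * S z) - 2 * \<beta> z * (n z - \<beta> z * T z)) 0"
proof -
  have "\<exists>a b c e. cograd d\<tau> z a b c e \<and> c = u\<tau> z - 2 * \<alpha> z * (m z - \<alpha> z * S z) - 2 * \<beta> z * (n z - \<beta> z * T z) \<and> e = 0"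
    unfolding d\<tau>_def[abs_def]
    by (intro exI conjI, (rule tables cograd_intros)+)
      (simp_all add: u\<tau>_def algebra_simps power2_eq_square)
  then show thesis using that by blast
qed

lemma cograd_dlogW:
  obtains b where "cograd dlogW z ((A' z - A z - \<beta> z * K' z + \<alpha> z * K z) / W z - (dlogW z)\<^sup>2) b (ulogW z - d\<tau> z) 0"
proof -
  have "\<exists>a b c e. cograd dlogW z a b c e \<and> a = (A' z - A z - \<beta> z * K' z + \<alpha> z * K z) / W z - (dlogW z)\<^sup>2
    \<and> c = ulogW z - d\<tau> z \<and> e = 0"
    unfolding dlogW_def[abs_def]
    apply (intro exI conjI)
       apply (rule tables cograd_W cograd_intros W_nonzero)+
    using W_nonzero
      apply (simp_all add: dlogW_def[symmetric])
     apply (simp_all add: n_eq l_eq d\<tau>_def \<tau>_def beta_eq field_simps power2_eq_square)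
    done
  then show thesis using that by blast
qed

lemma cograd_ulogW:
  obtains a b where "cograd ulogW z a b (- u\<tau> z) 0"
proof -
  have "\<exists>a b c e. cograd ulogW z a b c e \<and> c = - u\<tau> z \<and> e = 0"
    unfolding ulogW_def[abs_def]
    apply (intro exI conjI)
       apply (rule tables cograd_W cograd_intros W_nonzero)+
    using W_nonzero
     apply (simp_all add: ulogW_def[symmetric])
    apply (simp add: n_eq l_eq u\<tau>_def \<tau>_def beta_eq field_simps power2_eq_square)
    done
  then show thesis using that by blast
qed

lemma cograd_E:
  "cograd E z (K' z + (T z)\<^sup>2 / 2 - (K z + (S z)\<^sup>2 / 2) + z $ 4 * (dlogW z * W z))
   (A' z + n z * T z - \<beta> z * (T z)\<^sup>2 / 2 - (A z + m z * S z - \<alpha> z * (S z)\<^sup>2 / 2) + z $ 4 * (ulogW z * W z))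
   (2 * n z - \<beta> z * T z - (2 * m z - \<alpha> z * S z) - z $ 4 * \<tau> z * W z) (W z)"
  unfolding E_def[abs_def]
  by (rule cograd_eq, (rule tables cograd_W cograd_intros)+) simp_all

lemma cograd_\<Xi>:
  "cograd \<Xi> z (\<Xi> z * (T z - S z)) (\<Xi> z * (n z - m z)) (\<Xi> z * W z) 0"
  unfolding \<Xi>_def[abs_def]
  by (rule cograd_eq, (rule phi.cograd_d[OF z] psi.cograd_d[OF z] cograd_intros phi.nonzero[OF z])+)
    (use phi.nonzero[OF z] in \<open>simp_all add: W_def field_simps\<close>)

lemma cograd_H:
  "cograd H z
    (\<Xi> z * (E z * (T z - 2 * S z) + (K' z + (T z)\<^sup>2 / 2 - (K z + (S z)\<^sup>2 / 2) + z $ 4 * (dlogW z * W z))) / dxu \<Phi> z)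
    (\<Xi> z * (E z * (n z - 2 * m z) + (A' z + n z * T z - \<beta> z * (T z)\<^sup>2 / 2 - (A z + m z * S z - \<alpha> z * (S z)\<^sup>2 / 2) + z $ 4 * (ulogW z * W z))) / dxu \<Phi> z)
    (\<Xi> z * (E z * (W z - \<alpha> z) + (2 * n z - \<beta> z * T z - (2 * m z - \<alpha> z * S z) - z $ 4 * \<tau> z * W z)) / dxu \<Phi> z)
    (\<Xi> z * W z / dxu \<Phi> z)"
  unfolding H_def[abs_def]
  by (rule cograd_eq, (rule phi.cograd_d[OF z] cograd_\<Xi> cograd_E cograd_intros phi.nonzero[OF z])+)
    (use phi.nonzero[OF z] in \<open>simp_all add: field_simps\<close>)

lemma cograd_f_form: obtains a b where "cograd f_form z a b (fp_form z) (- I1_form z)"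
proof -
  obtain b where dlogW: "cograd dlogW z ((A' z - A z - \<beta> z * K' z + \<alpha> z * K z) / W z - (dlogW z)\<^sup>2) b (ulogW z - d\<tau> z) 0"
    by (rule cograd_dlogW)
  have "\<exists>a b c e. cograd f_form z a b c e \<and> c = fp_form z \<and> e = - I1_form z"
    unfolding f_form_def[abs_def]
    apply (intro exI conjI)
       apply (rule tables dlogW cograd_W cograd_\<tau> cograd_intros W_nonzero)+
    using W_nonzero apply (simp_all add: fp_form_def I1_form_def)
    apply (simp_all add: field_simps power2_eq_square)
    apply (simp_all add: beta_eq \<tau>_def field_simps power2_eq_square)
    done
  then show thesis using that by blast
qed

lemma cograd_fp_form: obtains a b e where "cograd fp_form z a b (3 * ((\<alpha> z)^3 + (\<beta> z)^3) * (z $ 4)\<^sup>2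
   + 6 * (u\<tau> z - \<alpha> z * (m z - \<alpha> z * S z) - \<beta> z * (n z - \<beta> z * T z)) * z $ 4
   + 6 * (C z - C' z + \<beta> z * A z - \<alpha> z * A' z) / W z) e"
proof -
  obtain ay bY where Y: "cograd ulogW z ay bY (- u\<tau> z) 0" by (rule cograd_ulogW)
  obtain ad bd where dt: "cograd d\<tau> z ad bd (u\<tau> z - 2 * \<alpha> z * (m z - \<alpha> z * S z) - 2 * \<beta> z * (n z - \<beta> z * T z)) 0"
    by (rule cograd_d\<tau>)
  have "\<exists>a b c e. cograd fp_form z a b c e \<and> c = 3 * ((\<alpha> z)^3 + (\<beta> z)^3) * (z $ 4)\<^sup>2
   + 6 * (u\<tau> z - \<alpha> z * (m z - \<alpha> z * S z) - \<beta> z * (n z - \<beta> z * T z)) * z $ 4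
   + 6 * (C z - C' z + \<beta> z * A z - \<alpha> z * A' z) / W z"
    unfolding fp_form_def[abs_def]
    apply (intro exI conjI)
       apply (rule tables Y dt cograd_W cograd_intros W_nonzero)+
    using W_nonzero
    apply (simp add: \<tau>_def beta_eq field_simps power2_eq_square power3_eq_cube)
    done
  then show thesis using that by blast
qed

lemma cograd_I1_form: obtains b where "cograd I1_form z
   (3 * ((A' z - A z - \<beta> z * K' z + \<alpha> z * K z) / W z - (dlogW z)\<^sup>2 - d\<tau> z * z $ 4)) b
   (3 * (ulogW z - d\<tau> z + ((\<alpha> z)\<^sup>2 + (\<beta> z)\<^sup>2) * z $ 4)) (- 3 * \<tau> z)"
proof -
  obtain b where dlogW: "cograd dlogW z ((A' z - A z - \<beta> z * K' z + \<alpha> z * K z) / W z - (dlogW z)\<^sup>2) b (ulogW z - d\<tau> z) 0"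
    by (rule cograd_dlogW)
  show thesis
    apply (rule that)
    unfolding I1_form_def[abs_def]
    apply (rule cograd_eq)
        apply (rule dlogW cograd_\<tau> cograd_intros)+
       apply (simp add: algebra_simps, rule refl, simp_all add: algebra_simps)
    done
qed

lemma cograd_I2_form: obtains a b where "cograd I2_form z a b
   (\<alpha> z * \<beta> z * \<tau> z * (z $ 4)\<^sup>2
     + ((ulogW z - d\<tau> z) * \<tau> z - dlogW z * ((\<alpha> z)\<^sup>2 + (\<beta> z)\<^sup>2) - 3 * u\<tau> z
         + 2 * \<alpha> z * (m z - \<alpha> z * S z) + 2 * \<beta> z * (n z - \<beta> z * T z)) * z $ 4
     - 2 * dlogW z * (ulogW z - d\<tau> z) - 2 * (2 * (C z - C' z) + \<beta> z * A z - \<alpha> z * A' z) / W z)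
   (- 2 * \<alpha> z * \<beta> z * z $ 4 + dlogW z * \<tau> z + 2 * ulogW z - d\<tau> z)"
proof -
  obtain ay bY where Y: "cograd ulogW z ay bY (- u\<tau> z) 0" by (rule cograd_ulogW)
  obtain ad bd where dt: "cograd d\<tau> z ad bd (u\<tau> z - 2 * \<alpha> z * (m z - \<alpha> z * S z) - 2 * \<beta> z * (n z - \<beta> z * T z)) 0"
    by (rule cograd_d\<tau>)
  obtain b where dlogW: "cograd dlogW z ((A' z - A z - \<beta> z * K' z + \<alpha> z * K z) / W z - (dlogW z)\<^sup>2) b (ulogW z - d\<tau> z) 0"
    by (rule cograd_dlogW)
  have "\<exists>a b c e. cograd I2_form z a b c e \<and> c =
   (\<alpha> z * \<beta> z * \<tau> z * (z $ 4)\<^sup>2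
     + ((ulogW z - d\<tau> z) * \<tau> z - dlogW z * ((\<alpha> z)\<^sup>2 + (\<beta> z)\<^sup>2) - 3 * u\<tau> z
         + 2 * \<alpha> z * (m z - \<alpha> z * S z) + 2 * \<beta> z * (n z - \<beta> z * T z)) * z $ 4
     - 2 * dlogW z * (ulogW z - d\<tau> z) - 2 * (2 * (C z - C' z) + \<beta> z * A z - \<alpha> z * A' z) / W z)
   \<and> e = - 2 * \<alpha> z * \<beta> z * z $ 4 + dlogW z * \<tau> z + 2 * ulogW z - d\<tau> z"
    unfolding I2_form_def[abs_def]
    apply (intro exI conjI)
       apply (rule tables Y dt dlogW cograd_\<tau> cograd_W cograd_intros W_nonzero)+
    using W_nonzero
    apply (simp_all add: \<tau>_def beta_eq field_simps power2_eq_square power3_eq_cube)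
    done
  then show thesis using that by blast
qed

lemma cograd_a2:
  "cograd a2 z
  ((A' z + n z * T z - \<beta> z * (T z)\<^sup>2 / 2 - (A z + m z * S z - \<alpha> z * (S z)\<^sup>2 / 2)
      - (m z - \<alpha> z * S z) * E z - \<alpha> z * (K' z + (T z)\<^sup>2 / 2 - (K z + (S z)\<^sup>2 / 2) + z $ 4 * (dlogW z * W z))) / 2)
  ((C' z + (n z)\<^sup>2 + l z * T z - 2 * \<beta> z * n z * T z + (\<beta> z)\<^sup>2 * (T z)\<^sup>2 / 2
    - (C z + (m z)\<^sup>2 + k z * S z - 2 * \<alpha> z * m z * S z + (\<alpha> z)\<^sup>2 * (S z)\<^sup>2 / 2)
    - (k z - \<alpha> z * m z) * E z - \<alpha> z * (A' z + n z * T z - \<beta> z * (T z)\<^sup>2 / 2 - (A z + m z * S z - \<alpha> z * (S z)\<^sup>2 / 2) + z $ 4 * (ulogW z * W z))) / 2)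
  ((l z - n z * \<beta> z - (k z - m z * \<alpha> z) + (\<alpha> z)\<^sup>2 * E z
     - \<alpha> z * (2 * n z - \<beta> z * T z - (2 * m z - \<alpha> z * S z) - z $ 4 * \<tau> z * W z)) / 2)
  (- (\<alpha> z * W z / 2))"
  unfolding a2_def[abs_def]
  by (rule cograd_eq, (rule tables cograd_E cograd_intros)+) (simp_all add: algebra_simps)

end

text \<open>
  After division by \<open>\<Xi> / P\<^sup>2\<close> the transformed equation is affine in the third derivative of \<open>u\<close>: the
  coefficient is \<open>W\<close>, the rest \<open>X + q Y\<close> collects the derivatives of \<open>H\<close> by \<open>d\<close> and \<open>p\<close>.
\<close>

lemma ode_imp_eq_f_form:
  assumes z: "z \<in> U" and ode: "Dhat g H z / dxu \<Phi> z = 3/2 * (H z)\<^sup>2 / \<Xi> z"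
  shows "g z = f_form z"
proof -
  have p: "dxu \<Phi> z \<noteq> 0" by (rule phi.nonzero[OF z])
  have x: "\<Xi> z \<noteq> 0" using p psi.nonzero[OF z] by (simp add: \<Xi>_def)
  note W_nonzero = W_nonzero[OF z]
  define X where "X = E z * (T z - 2 * S z) + (K' z + (T z)\<^sup>2 / 2 - (K z + (S z)\<^sup>2 / 2) + z $ 4 * (dlogW z * W z))"
  define Y where "Y = E z * (W z - \<alpha> z) + (2 * n z - \<beta> z * T z - (2 * m z - \<alpha> z * S z) - z $ 4 * \<tau> z * W z)"
  have "Dhat g H z / dxu \<Phi> z = \<Xi> z / (dxu \<Phi> z)\<^sup>2 * (X + z $ 4 * Y + g z * W z)"
    unfolding cograd_pds(5)[OF cograd_H[OF z]] X_def[symmetric] Y_def[symmetric]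
    using p by (simp add: field_simps power2_eq_square)
  moreover have "3/2 * (H z)\<^sup>2 / \<Xi> z = \<Xi> z / (dxu \<Phi> z)\<^sup>2 * (3/2 * (E z)\<^sup>2)"
    using x p by (simp add: H_def field_simps power2_eq_square)
  ultimately have "\<Xi> z / (dxu \<Phi> z)\<^sup>2 * (X + z $ 4 * Y + g z * W z)
      = \<Xi> z / (dxu \<Phi> z)\<^sup>2 * (3/2 * (E z)\<^sup>2)"
    using ode by metis
  moreover have "\<Xi> z / (dxu \<Phi> z)\<^sup>2 \<noteq> 0" using x p by simp
  ultimately have "X + z $ 4 * Y + g z * W z = 3/2 * (E z)\<^sup>2"
    by (metis mult_left_cancel)
  then have "g z * W z = 3/2 * (E z)\<^sup>2 - X - z $ 4 * Y"
    by (simp add: algebra_simps)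
  also have "\<dots> = f_form z * W z"
    using W_nonzero unfolding X_def Y_def by (simp add: f_form_def E_def n_eq[OF z] beta_eq[OF z] \<tau>_def field_simps power2_eq_square)
  finally show ?thesis using W_nonzero by simp
qed

end

section \<open>Invariants and auxiliary functions of the pullback\<close>

locale pulled_back_equation = base_pair +
  fixes f :: "jet2 \<Rightarrow> complex"
  assumes f_eq_form: "z \<in> U \<Longrightarrow> f z = f_form z"
begin

lemma cograd_eq_on:
  "\<forall>z\<in>U. G z = G' z \<Longrightarrow> z \<in> U \<Longrightarrow> cograd G' z a b c e \<Longrightarrow> cograd G z a b c e"
  by (rule phi.cograd_on_U) auto

lemma f_eq: "\<forall>z\<in>U. f z = f_form z"
  by (simp add: f_eq_form)

text \<open>
  \<open>J = \<Delta> / (2 P Q)\<close> and \<open>a\<^sub>1 = \<Delta> / P\<close>. As \<open>\<xi>\<^sub>p = \<Delta> / P\<^sup>2\<close> has to equal \<open>2 \<xi> J\<close>, this is the sign of the square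
  root that the system requires.
\<close>

definition J where "J z = W z / 2"
definition a1 where "a1 z = dxu \<Psi> z * W z"

lemma pd_f:
  assumes "z \<in> U" shows "pd 4 f z = - I1_form z" "pd 3 f z = fp_form z"
proof -
  obtain a b where "cograd f_form z a b (fp_form z) (- I1_form z)" using assms by (rule cograd_f_form)
  then have "cograd f z a b (fp_form z) (- I1_form z)" by (rule cograd_eq_on[OF f_eq assms])
  then show "pd 4 f z = - I1_form z" "pd 3 f z = fp_form z" by (simp_all add: cograd_pds)
qed

lemma I1_eq: "\<forall>z\<in>U. I1 f z = I1_form z"
  by (simp add: I1_def pd_f)

lemmas I1 = bspec[OF I1_eq]

lemma pd3_f_eq: "\<forall>z\<in>U. pd 3 f z = fp_form z"
  by (simp add: pd_f)

context
  fixes z assumes z: "z \<in> U"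
begin

lemma pd_I1:
  "Dhat f (I1 f) z = 3 * ((A' z - A z - \<beta> z * K' z + \<alpha> z * K z) / W z - (dlogW z)\<^sup>2 - d\<tau> z * z $ 4)
     + z $ 4 * (3 * (ulogW z - d\<tau> z + ((\<alpha> z)\<^sup>2 + (\<beta> z)\<^sup>2) * z $ 4)) - 3 * \<tau> z * f_form z"
  "pd 3 (I1 f) z = 3 * (ulogW z - d\<tau> z + ((\<alpha> z)\<^sup>2 + (\<beta> z)\<^sup>2) * z $ 4)"
  "pd 4 (I1 f) z = - 3 * \<tau> z"
proof -
  obtain b where "cograd I1_form z
   (3 * ((A' z - A z - \<beta> z * K' z + \<alpha> z * K z) / W z - (dlogW z)\<^sup>2 - d\<tau> z * z $ 4)) b
   (3 * (ulogW z - d\<tau> z + ((\<alpha> z)\<^sup>2 + (\<beta> z)\<^sup>2) * z $ 4)) (- 3 * \<tau> z)" using z by (rule cograd_I1_form)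
  note 1 = cograd_eq_on[OF I1_eq z this]
  show "Dhat f (I1 f) z = 3 * ((A' z - A z - \<beta> z * K' z + \<alpha> z * K z) / W z - (dlogW z)\<^sup>2 - d\<tau> z * z $ 4)
     + z $ 4 * (3 * (ulogW z - d\<tau> z + ((\<alpha> z)\<^sup>2 + (\<beta> z)\<^sup>2) * z $ 4)) - 3 * \<tau> z * f_form z"
    by (simp add: cograd_pds(5)[OF 1] f_eq_form[OF z])
  show "pd 3 (I1 f) z = 3 * (ulogW z - d\<tau> z + ((\<alpha> z)\<^sup>2 + (\<beta> z)\<^sup>2) * z $ 4)"
    by (simp add: cograd_pds(3)[OF 1])
  show "pd 4 (I1 f) z = - 3 * \<tau> z"
    by (simp add: cograd_pds(4)[OF 1])
qed

lemma pd_pd_f: "pd 3 (pd 3 f) z = 3 * ((\<alpha> z)^3 + (\<beta> z)^3) * (z $ 4)\<^sup>2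
   + 6 * (u\<tau> z - \<alpha> z * (m z - \<alpha> z * S z) - \<beta> z * (n z - \<beta> z * T z)) * z $ 4
   + 6 * (C z - C' z + \<beta> z * A z - \<alpha> z * A' z) / W z"
proof -
  obtain a b e where "cograd fp_form z a b (3 * ((\<alpha> z)^3 + (\<beta> z)^3) * (z $ 4)\<^sup>2
   + 6 * (u\<tau> z - \<alpha> z * (m z - \<alpha> z * S z) - \<beta> z * (n z - \<beta> z * T z)) * z $ 4
   + 6 * (C z - C' z + \<beta> z * A z - \<alpha> z * A' z) / W z) e" using z by (rule cograd_fp_form)
  from cograd_pds(3)[OF cograd_eq_on[OF pd3_f_eq z this]] show ?thesis .
qed

lemma I2: "I2 f z = I2_form z"
  unfolding I2_def pd_I1 I1[OF z] pd_f(2)[OF z] fp_form_def I1_form_def f_form_def I2_form_def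
  using W_nonzero[OF z] by (simp add: beta_eq[OF z] \<tau>_def field_simps power2_eq_square)

lemma I3: "I3 f z = \<tau> z / 2"
  by (simp add: I3_def pd_I1)

end

context
  fixes z assumes z: "z \<in> U"
begin

lemma I2_eq: "\<forall>z\<in>U. I2 f z = I2_form z"
  by (simp add: I2)

lemma I3_eq: "\<forall>z\<in>U. I3 f z = \<tau> z / 2"
  by (simp add: I3)

lemma pd_I2:
   "pd 3 (I2 f) z = (\<alpha> z * \<beta> z * \<tau> z * (z $ 4)\<^sup>2
     + ((ulogW z - d\<tau> z) * \<tau> z - dlogW z * ((\<alpha> z)\<^sup>2 + (\<beta> z)\<^sup>2) - 3 * u\<tau> z
         + 2 * \<alpha> z * (m z - \<alpha> z * S z) + 2 * \<beta> z * (n z - \<beta> z * T z)) * z $ 4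
     - 2 * dlogW z * (ulogW z - d\<tau> z) - 2 * (2 * (C z - C' z) + \<beta> z * A z - \<alpha> z * A' z) / W z)"
   "pd 4 (I2 f) z = - 2 * \<alpha> z * \<beta> z * z $ 4 + dlogW z * \<tau> z + 2 * ulogW z - d\<tau> z"
proof -
  obtain a b where "cograd I2_form z a b (\<alpha> z * \<beta> z * \<tau> z * (z $ 4)\<^sup>2
     + ((ulogW z - d\<tau> z) * \<tau> z - dlogW z * ((\<alpha> z)\<^sup>2 + (\<beta> z)\<^sup>2) - 3 * u\<tau> z
         + 2 * \<alpha> z * (m z - \<alpha> z * S z) + 2 * \<beta> z * (n z - \<beta> z * T z)) * z $ 4
     - 2 * dlogW z * (ulogW z - d\<tau> z) - 2 * (2 * (C z - C' z) + \<beta> z * A z - \<alpha> z * A' z) / W z)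
     (- 2 * \<alpha> z * \<beta> z * z $ 4 + dlogW z * \<tau> z + 2 * ulogW z - d\<tau> z)" using z by (rule cograd_I2_form)
  note 1 = cograd_eq_on[OF I2_eq z this]
  show "pd 3 (I2 f) z = (\<alpha> z * \<beta> z * \<tau> z * (z $ 4)\<^sup>2
     + ((ulogW z - d\<tau> z) * \<tau> z - dlogW z * ((\<alpha> z)\<^sup>2 + (\<beta> z)\<^sup>2) - 3 * u\<tau> z
         + 2 * \<alpha> z * (m z - \<alpha> z * S z) + 2 * \<beta> z * (n z - \<beta> z * T z)) * z $ 4
     - 2 * dlogW z * (ulogW z - d\<tau> z) - 2 * (2 * (C z - C' z) + \<beta> z * A z - \<alpha> z * A' z) / W z)"
    "pd 4 (I2 f) z = - 2 * \<alpha> z * \<beta> z * z $ 4 + dlogW z * \<tau> z + 2 * ulogW z - d\<tau> z"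
    by (simp_all only: cograd_pds(3,4)[OF 1])
qed

lemma I5: "I5 f z = (W z / 2)\<^sup>2"
proof -
  have "cograd (\<lambda>z. \<tau> z / 2) z (d\<tau> z / 2) (u\<tau> z / 2) (- ((\<alpha> z)\<^sup>2 + (\<beta> z)\<^sup>2) / 2) (0 / 2)"
    by (rule cograd_divide_numeral[OF cograd_\<tau>[OF z]])
  from cograd_pds(3)[OF cograd_eq_on[OF I3_eq z this]]
  have v: "pd 3 (I3 f) z = - ((\<alpha> z)\<^sup>2 + (\<beta> z)\<^sup>2) / 2" .
  show ?thesis
    unfolding I5_def I3[OF z] v by (simp add: \<tau>_def W_def power2_eq_square field_simps)
qed


lemma a1_nonzero: "a1 z \<noteq> 0" and J_nonzero: "J z \<noteq> 0"
  using W_nonzero[OF z] psi.nonzero[OF z] by (simp_all add: J_def a1_def)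

lemmas invariant_values = I1[OF z] I2[OF z] I3[OF z] pd_I1[OF z] pd_I2 pd_pd_f[OF z]

lemma a1_system:
  "Dhat f a1 z = a1 z * a2 z / J z"
  "pd 2 a1 z = a1 z * (a2 z - I8 f (J z) (a2 z) z)"
  "pd 3 a1 z = a1 z * (J z - I3 f z)"
  "pd 4 a1 z = 0"
proof -
  have 1: "cograd a1 z (a1 z * (T z + dlogW z)) (a1 z * (n z + ulogW z)) (a1 z * (\<beta> z - \<tau> z)) 0"
    unfolding a1_def[abs_def]
    by (rule cograd_eq, (rule psi.cograd_d[OF z] cograd_W[OF z] cograd_intros)+) (simp_all add: a1_def algebra_simps)
  show "Dhat f a1 z = a1 z * a2 z / J z"
    using W_nonzero[OF z] unfolding cograd_pds(5)[OF 1] a2_def J_def E_def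
    by (simp add: field_simps n_eq[OF z] beta_eq[OF z] \<tau>_def)
  have "n z + ulogW z = a2 z - I8 f (J z) (a2 z) z"
    using W_nonzero[OF z] unfolding I8_def invariant_values a2_def J_def E_def
    by (simp add: field_simps n_eq[OF z] beta_eq[OF z] \<tau>_def d\<tau>_def I1_form_def power2_eq_square)
  then show "pd 2 a1 z = a1 z * (a2 z - I8 f (J z) (a2 z) z)"
    unfolding cograd_pds(2)[OF 1] by simp
  show "pd 3 a1 z = a1 z * (J z - I3 f z)"
    unfolding cograd_pds(3)[OF 1] invariant_values J_def by (simp add: field_simps \<tau>_def W_def)
  show "pd 4 a1 z = 0" by (rule cograd_pds(4)[OF 1])
qed

lemma a2_D: "Dhat f a2 z = (I2 f z * J z + (a2 z)\<^sup>2 / J z) / 2"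
  using W_nonzero[OF z] unfolding cograd_pds(5)[OF cograd_a2[OF z]] invariant_values f_eq_form[OF z] a2_def J_def
  by (simp add: E_def f_form_def I2_form_def field_simps n_eq[OF z] l_eq[OF z] beta_eq[OF z] \<tau>_def d\<tau>_def I1_form_def power2_eq_square)

lemma a2_q: "pd 4 a2 z = (J z)\<^sup>2 - I3 f z * J z"
  unfolding cograd_pds(4)[OF cograd_a2[OF z]] invariant_values J_def
  by (simp add: W_def \<tau>_def field_simps power2_eq_square)

lemma a2_p: "pd 3 a2 z = a2 z * J z + (J z)\<^sup>2 / 3 * I1 f z - a1 z * I10 f (J z) (a1 z) (a2 z) z"
proof -
  have i10: "a1 z * I10 f (J z) (a1 z) (a2 z) z =
     (J z * (pd 3 (I1 f) z - 3 * pd 4 (I2 f) z) + 3 * I3 f z * (I1 f z * J z + a2 z)) / 3"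
    using a1_nonzero by (simp add: I10_def)
  show ?thesis
   using W_nonzero[OF z] unfolding i10 unfolding cograd_pds(3)[OF cograd_a2[OF z]] invariant_values a2_def J_def
   by (simp add: E_def I1_form_def field_simps n_eq[OF z] l_eq[OF z] beta_eq[OF z] \<tau>_def d\<tau>_def power2_eq_square)
qed

text \<open>
  The equation into which \<open>f\<^sub>p\<^sub>p\<close> and \<open>I\<^sub>2\<^sub>p\<close> enter, and with them \<open>schwarz_uu\<close>. The factor \<open>a\<^sub>1\<close>
  cancels against the denominator of \<open>I\<^sub>9\<close>, after which \<open>W\<close> is the only denominator.
\<close>

lemma a2_u: "pd 2 a2 z = (a2 z)\<^sup>2 / 2 + (J z)\<^sup>2 / 2 * I2 f z - a1 z * I9 f (J z) (a1 z) (a2 z) z"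
proof -
  have i9: "a1 z * I9 f (J z) (a1 z) (a2 z) z = 1 / (18 * J z) *
    (- 3 * pd 3 (pd 3 f) z * (J z)^2
     - 2 * J z * pd 3 (I1 f) z * (I1 f z * J z - 6 * a2 z)
     + 3 * J z * pd 4 (I2 f) z * (I1 f z * J z - 9 * a2 z)
     - 9 * pd 3 (I2 f) z * (J z)^2
     - 2 * I3 f z * ((J z)^2 * ((I1 f z)^2 - (9/2) * I2 f z) - 12 * I1 f z * J z * a2 z + (9/2) * (a2 z)^2))"
    using a1_nonzero by (simp add: I9_def)
  show ?thesis
   using W_nonzero[OF z] unfolding i9 unfolding cograd_pds(2)[OF cograd_a2[OF z]] invariant_values a2_def J_def
   by (simp add: E_def I1_form_def I2_form_def field_simps n_eq[OF z] l_eq[OF z] beta_eq[OF z] \<tau>_def d\<tau>_def u\<tau>_def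
       power2_eq_square power3_eq_cube)
qed

section \<open>The determining system\<close>

lemma Xi_nonzero: "\<Xi> z \<noteq> 0"
  using psi.nonzero[OF z] phi.nonzero[OF z] by (simp add: \<Xi>_def)

lemma psi_d_eq: "dxu \<Psi> z = \<Xi> z * dxu \<Phi> z"
  using phi.nonzero[OF z] by (simp add: \<Xi>_def)

lemma Phi_system:
  "Dhat g \<Phi> z = dxu \<Phi> z" "pd 2 \<Phi> z = \<alpha> z * dxu \<Phi> z"
  "Dhat g \<Psi> z = dxu \<Psi> z" "pd 2 \<Psi> z = \<beta> z * dxu \<Psi> z"
  using cograd_pds[OF phi.cograd_base[OF z]] cograd_pds[OF psi.cograd_base[OF z]] by simp_all

lemma Xi_system:
  "Dhat g \<Xi> z = dxu \<Phi> z * H z"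
  "pd 2 \<Xi> z = 2 * \<Xi> z * a2 z + \<alpha> z * dxu \<Phi> z * H z"
  "pd 3 \<Xi> z = 2 * \<Xi> z * J z"
  unfolding cograd_pds[OF cograd_\<Xi>[OF z]] using phi.nonzero[OF z]
  by (simp_all add: H_def E_def a2_def J_def field_simps)

text \<open>
  With \<open>Q = \<Xi> P\<close> both sides are homogeneous in \<open>P\<close> and \<open>\<Xi>\<close>, so that these two factors cancel.
\<close>

lemma H_system:
  "Dhat f H z = dxu \<Phi> z * (3/2 * (H z)\<^sup>2 / \<Xi> z)"
  "pd 2 H z = 2 * H z * a2 z + 4 * (\<Xi> z)\<^sup>2 * ((a2 z)\<^sup>2 / (2 * a1 z) + (J z)\<^sup>2 / (2 * a1 z) * I2 f z)
     + \<alpha> z * dxu \<Phi> z * (3/2 * (H z)\<^sup>2 / \<Xi> z)"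
  "pd 3 H z = 2 * H z * J z + 4 * (\<Xi> z)\<^sup>2 * (a2 z * J z / a1 z + (J z)\<^sup>2 / (3 * a1 z) * I1 f z)"
  "pd 4 H z = 4 * (\<Xi> z)\<^sup>2 * ((J z)\<^sup>2 / a1 z)"
proof -
  define P X where "P = dxu \<Phi> z" and "X = \<Xi> z"
  have nz: "P \<noteq> 0" "X \<noteq> 0" "W z \<noteq> 0"
    using Xi_nonzero phi.nonzero[OF z] W_nonzero[OF z] by (auto simp: P_def X_def)
  note e = psi_d_eq P_def[symmetric] X_def[symmetric] E_def
  note r = field_simps n_eq[OF z] l_eq[OF z] beta_eq[OF z] \<tau>_def d\<tau>_def power2_eq_square
  show "Dhat f H z = dxu \<Phi> z * (3/2 * (H z)\<^sup>2 / \<Xi> z)"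
    unfolding cograd_pds(5)[OF cograd_H[OF z]] f_eq_form[OF z] f_form_def H_def e
    using nz by (simp add: r)
  show "pd 2 H z = 2 * H z * a2 z + 4 * (\<Xi> z)\<^sup>2 * ((a2 z)\<^sup>2 / (2 * a1 z) + (J z)\<^sup>2 / (2 * a1 z) * I2 f z)
     + \<alpha> z * dxu \<Phi> z * (3/2 * (H z)\<^sup>2 / \<Xi> z)"
    unfolding cograd_pds(2)[OF cograd_H[OF z]] I2[OF z] I2_form_def H_def a1_def J_def a2_def e
    using nz by (simp add: r)
  show "pd 3 H z = 2 * H z * J z + 4 * (\<Xi> z)\<^sup>2 * (a2 z * J z / a1 z + (J z)\<^sup>2 / (3 * a1 z) * I1 f z)"
    unfolding cograd_pds(3)[OF cograd_H[OF z]] I1[OF z] I1_form_def H_def a1_def J_def a2_def e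
    using nz by (simp add: r)
  show "pd 4 H z = 4 * (\<Xi> z)\<^sup>2 * ((J z)\<^sup>2 / a1 z)"
    unfolding cograd_pds(4)[OF cograd_H[OF z]] a1_def J_def e
    using nz by (simp add: r)
qed

lemma b7_b8: "(a1 z / J z * I3 f z - a1 z) / (2 * \<Xi> z) = \<alpha> z * dxu \<Phi> z"
  "a1 z / J z / (2 * \<Xi> z) = dxu \<Phi> z"
  unfolding a1_def J_def I3[OF z] psi_d_eq \<tau>_def beta_eq[OF z]
  using W_nonzero[OF z] Xi_nonzero by (simp_all add: field_simps)

lemma last_equation:
  "\<alpha> z * dxu \<Phi> z * dxu \<Psi> z = dxu \<Phi> z * (\<beta> z * dxu \<Psi> z - a1 z)"
  by (simp add: a1_def W_def algebra_simps)

end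

end

lemma xu_components: "xu z = (\<chi> j. z $ (if j = 1 then 1 else 2))"
  by (simp add: vec_eq_iff forall_2 xu_def)

lemma open_xu_image: "open U \<Longrightarrow> open (xu ` U)"
proof (rule open_surjective_linear_image)
  show "linear xu" by (rule linearI) (simp_all add: xu_components vec_eq_iff)
  show "surj xu"
    by (rule surjI[of _ "\<lambda>y. vector [y $ 1, y $ 2, 0, 0]"]) (simp add: vec_eq_iff forall_2 xu_def)
qed

lemma holomorphic_xu:
  "holomorphic_several h (xu ` U) \<Longrightarrow> holomorphic_several (h \<circ> xu) U"
  unfolding o_def xu_components
  by (rule holomorphic_several_compose_components) (auto simp flip: xu_components)

lemma pd_xu:
  "pd 1 (h \<circ> xu) z = pd 1 h (xu z)" "pd 2 (h \<circ> xu) z = pd 2 h (xu z)"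
  "pd 3 (h \<circ> xu) z = 0" "pd 4 (h \<circ> xu) z = 0"
proof -
  have 1: "xu (\<chi> j. if j = 1 then w else z $ j) = (\<chi> j. if j = 1 then w else xu z $ j)" for w
    by (simp add: vec_eq_iff forall_2 xu_def)
  have 2: "xu (\<chi> j. if j = 2 then w else z $ j) = (\<chi> j. if j = 2 then w else xu z $ j)" for w
    by (simp add: vec_eq_iff forall_2 xu_def)
  have 3: "xu (\<chi> j. if j = 3 then w else z $ j) = xu z" "xu (\<chi> j. if j = 4 then w else z $ j) = xu z" for w
    by (simp_all add: vec_eq_iff forall_2 xu_def)
  show "pd 1 (h \<circ> xu) z = pd 1 h (xu z)" "pd 2 (h \<circ> xu) z = pd 2 h (xu z)"
    "pd 3 (h \<circ> xu) z = 0" "pd 4 (h \<circ> xu) z = 0"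
    by (simp_all add: pd_def o_def 1 2 3) (simp_all add: xu_def)
qed

lemma Dhat_cong:
  assumes "open U" "holomorphic_several F U" "\<And>z. z \<in> U \<Longrightarrow> F z = G z" "z \<in> U"
  shows "Dhat g G z = Dhat g F z"
  by (simp add: Dhat_def pd_cong[OF assms])

theorem proposition4p2:
  fixes U :: "jet2 set"
    and f :: "jet2 \<Rightarrow> complex"
    and \<phi> \<psi> :: "complex^2 \<Rightarrow> complex"
    and \<xi> \<eta> fbar :: "jet2 \<Rightarrow> complex"
  assumes "open U"
    and "holomorphic_several f U"
    and "equivalent_under U f {z. z $ 3 \<noteq> 0} (\<lambda>z. 3/2 * (z $ 4)^2 / z $ 3) \<phi> \<psi>"
  defines "\<xi> \<equiv> \<lambda>z. Dhat f (\<psi> \<circ> xu) z / Dhat f (\<phi> \<circ> xu) z"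
    and "\<eta> \<equiv> \<lambda>z. Dhat f \<xi> z / Dhat f (\<phi> \<circ> xu) z"
    and "fbar \<equiv> \<lambda>z. 3/2 * (\<eta> z)^2 / \<xi> z"
  shows "\<exists>(a\<^sub>1 :: complex^3 \<Rightarrow> complex) (a\<^sub>2 :: jet2 \<Rightarrow> complex) (J\<^sub>5 :: jet2 \<Rightarrow> complex)
            (b :: nat \<Rightarrow> jet2 \<Rightarrow> complex).
    holomorphic_several a\<^sub>1 (xup ` U) \<and> holomorphic_several a\<^sub>2 U \<and> holomorphic_several J\<^sub>5 U \<and>
    (\<forall>z\<in>U.
      a\<^sub>1 (xup z) \<noteq> 0 \<and> J\<^sub>5 z \<noteq> 0 \<and> (J\<^sub>5 z)^2 = I5 f z \<and>
      Bmat (\<lambda>i. b i z) = matrix_inv (Mmat (\<xi> z) (\<eta> z)) ** Nmat f (J\<^sub>5 z) (a\<^sub>1 (xup z)) (a\<^sub>2 z) z \<and>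
      Dhat f a\<^sub>2 z = - b 16 z / b 17 z \<and>
      pd 2 a\<^sub>2 z = - b 13 z / b 17 z \<and>
      pd 3 a\<^sub>2 z = - b 14 z / b 17 z \<and>
      pd 4 a\<^sub>2 z = - b 15 z / b 17 z \<and>
      Dhat f (a\<^sub>1 \<circ> xup) z = - b 11 z / b 12 z \<and>
      pd 2 (a\<^sub>1 \<circ> xup) z = - b 9 z / b 12 z \<and>
      pd 3 (a\<^sub>1 \<circ> xup) z = - b 10 z / b 12 z \<and>
      pd 4 (a\<^sub>1 \<circ> xup) z = 0 \<and>
      Dhat f \<eta> z = b 8 z * fbar z \<and>
      pd 2 \<eta> z = b 4 z + b 7 z * fbar z \<and>
      pd 3 \<eta> z = b 5 z \<and>
      pd 4 \<eta> z = b 6 z \<and>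
      Dhat f \<xi> z = b 8 z * \<eta> z \<and>
      pd 2 \<xi> z = b 2 z + b 7 z * \<eta> z \<and>
      pd 3 \<xi> z = b 3 z \<and>
      Dhat f (\<phi> \<circ> xu) z = b 8 z \<and>
      pd 2 (\<phi> \<circ> xu) z = b 7 z \<and>
      b 7 z * Dhat f (\<psi> \<circ> xu) z = b 8 z * (pd 2 (\<psi> \<circ> xu) z - b 1 z))" (is "\<exists>a\<^sub>1 a\<^sub>2 J\<^sub>5 b. ?P a\<^sub>1 a\<^sub>2 J\<^sub>5 b")
proof -
  let ?\<Phi> = "\<phi> \<circ> xu" and ?\<Psi> = "\<psi> \<circ> xu"
  have hol: "holomorphic_several \<phi> (xu ` U)" "holomorphic_several \<psi> (xu ` U)"
    and det: "\<And>z. z \<in> U \<Longrightarrow> pd 1 \<phi> (xu z) * pd 2 \<psi> (xu z) - pd 2 \<phi> (xu z) * pd 1 \<psi> (xu z) \<noteq> 0"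
    and eqv: "\<And>z r. z \<in> U \<Longrightarrow> Dhat (\<lambda>_. r) ?\<Phi> z \<noteq> 0 \<and> pbar (\<lambda>_. r) \<phi> \<psi> z \<noteq> 0 \<and>
       (r = f z \<longleftrightarrow> rbar (\<lambda>_. r) \<phi> \<psi> z = 3/2 * (qbar (\<lambda>_. r) \<phi> \<psi> z)^2 / pbar (\<lambda>_. r) \<phi> \<psi> z)"
    using assms(3) unfolding equivalent_under_def point_transformation_def prolong2_def by auto
  have Dhat_base: "Dhat g (h \<circ> xu) z = dxu (h \<circ> xu) z" for g h z
    by (simp add: Dhat_def dxu_def pd_xu)
  have dxu_base: "dxu (h \<circ> xu) z = pd 1 h (xu z) + z $ 3 * pd 2 h (xu z)" for h z
    by (simp add: dxu_def pd_xu)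
  \<comment> \<open>The target hypersurface lies over \<open>p \<noteq> 0\<close>, hence \<open>Q / P \<noteq> 0\<close>.\<close>
  have P: "dxu ?\<Phi> z \<noteq> 0" and Q: "dxu ?\<Psi> z \<noteq> 0" if "z \<in> U" for z
    using eqv[OF that, of 0] by (auto simp: pbar_def Dhat_base)
  have jet_u_neq: "jet_u ?\<Psi> z \<noteq> jet_u ?\<Phi> z" if z: "z \<in> U" for z
  proof
    assume "jet_u ?\<Psi> z = jet_u ?\<Phi> z"
    then have "pd 2 ?\<Psi> z * dxu ?\<Phi> z = pd 2 ?\<Phi> z * dxu ?\<Psi> z"
      using P[OF z] Q[OF z] by (simp add: jet_u_def field_simps)
    with det[OF z] show False by (simp add: dxu_base pd_xu algebra_simps)
  qed
  interpret base_pair U ?\<Phi> ?\<Psi>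
    by unfold_locales (use assms(1) hol P Q jet_u_neq in \<open>simp_all add: pd_xu holomorphic_xu\<close>)
  have holXi: "holomorphic_several \<Xi> U"
    by (rule cograd_imp_holomorphic) (use cograd_\<Xi> in blast)
  have holH: "holomorphic_several H U"
    by (rule cograd_imp_holomorphic) (use cograd_H in blast)
  have pbar: "\<Xi> z = pbar g \<phi> \<psi> z" for g z
    by (simp add: pbar_def \<Xi>_def Dhat_base)
  have qbar: "H z = qbar g \<phi> \<psi> z" if z: "z \<in> U" for g z
  proof -
    have "pbar g \<phi> \<psi> = \<Xi>" using pbar by auto
    then show ?thesis
      unfolding qbar_def using cograd_pds(5)[OF cograd_\<Xi>[OF z], of g]
      by (simp add: H_def E_def Dhat_base algebra_simps)
  qed
  \<comment> \<open>Equivalence is used at the single third order jet \<open>r = f z\<close> over \<open>z\<close>, where the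
    unrestricted total derivative is the one of the equation.\<close>
  have f_eq: "f z = f_form z" if z: "z \<in> U" for z
  proof -
    have "rbar (\<lambda>_. f z) \<phi> \<psi> z = 3/2 * (qbar (\<lambda>_. f z) \<phi> \<psi> z)^2 / pbar (\<lambda>_. f z) \<phi> \<psi> z"
      using eqv[OF z, of "f z"] by blast
    moreover have "Dhat (\<lambda>_. f z) (qbar (\<lambda>_. f z) \<phi> \<psi>) z = Dhat (\<lambda>_. f z) H z"
      by (rule Dhat_cong[OF assms(1) holH _ z]) (rule qbar)
    ultimately have "Dhat (\<lambda>_. f z) H z / dxu ?\<Phi> z = 3/2 * (H z)^2 / \<Xi> z"
      unfolding rbar_def Dhat_base qbar[OF z, symmetric] pbar[symmetric] by metis
    from ode_imp_eq_f_form[OF z this] show ?thesis .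
  qed
  interpret pulled_back_equation U ?\<Phi> ?\<Psi> f
    by unfold_locales (rule f_eq)
  have xi: "\<xi> = \<Xi>" by (auto simp: \<xi>_def \<Xi>_def Dhat_base)
  have eta: "H z = \<eta> z" if "z \<in> U" for z
    using qbar[OF that, of f] pbar[of _ f] unfolding \<eta>_def qbar_def xi by (metis ext)
  \<comment> \<open>The formula \<open>\<psi>\<^sub>u - \<phi>\<^sub>u Q / P = \<Delta> / P\<close>, as a function of the first three coordinates. It is written with
    component selections, to which the lemma on compositions applies.\<close>
  define A1 where "A1 = (\<lambda>y :: complex^3.
    pd 2 \<psi> (\<chi> j. y $ (if j = 1 then 1 else 2)) -
    pd 2 \<phi> (\<chi> j. y $ (if j = 1 then 1 else 2)) *
    (pd 1 \<psi> (\<chi> j. y $ (if j = 1 then 1 else 2)) + y $ 3 * pd 2 \<psi> (\<chi> j. y $ (if j = 1 then 1 else 2))) /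
    (pd 1 \<phi> (\<chi> j. y $ (if j = 1 then 1 else 2)) + y $ 3 * pd 2 \<phi> (\<chi> j. y $ (if j = 1 then 1 else 2))))"
  have xup: "(\<chi> j. xup z $ (if j = 1 then 1 else 2)) = xu z" "xup z $ 3 = z $ 3" for z
    by (simp_all add: xup_def xu_def vec_eq_iff forall_2)
  have A1: "A1 (xup z) = a1 z" if z: "z \<in> U" for z
    using P[OF z] Q[OF z] unfolding A1_def xup a1_def W_def jet_u_def dxu_base[symmetric]
    by (simp add: pd_xu field_simps)
  have holA1: "holomorphic_several A1 (xup ` U)"
    unfolding A1_def
    by (intro holomorphic_several_diff holomorphic_several_divide holomorphic_several_mult
        holomorphic_several_add holomorphic_several_component
        holomorphic_several_compose_components[where V = "xu ` U"] holomorphic_several_pd hol open_xu_image assms(1))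
      (use P in \<open>auto simp: xup dxu_base\<close>)
  have hola1: "holomorphic_several a1 U"
    unfolding a1_def[abs_def]
    by (rule cograd_imp_holomorphic, (intro exI)?, rule cograd_mult[OF psi.cograd_d cograd_W])
  have hola2: "holomorphic_several a2 U"
    by (rule cograd_imp_holomorphic) (use cograd_a2 in blast)
  have holJ: "holomorphic_several J U"
    unfolding J_def[abs_def]
    by (rule cograd_imp_holomorphic, (intro exI)?, rule cograd_divide_numeral[OF cograd_W])
  \<comment> \<open>The tables know \<open>\<xi>\<close> and \<open>\<eta>\<close> as \<open>\<Xi>\<close> and \<open>H\<close>; outside of \<open>U\<close> the functions \<open>\<eta>\<close> and \<open>H\<close> may differ.\<close>
  define b where "b = (\<lambda>i z. bcoeff f (J z) (a1 z) (a2 z) (\<Xi> z) (H z) z i)"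
  have b: "b 1 z = a1 z" "b 2 z = 2 * \<Xi> z * a2 z" "b 3 z = 2 * \<Xi> z * J z"
    "b 4 z = 2 * H z * a2 z + 4 * (\<Xi> z)\<^sup>2 * ((a2 z)\<^sup>2 / (2 * a1 z) + (J z)\<^sup>2 / (2 * a1 z) * I2 f z)"
    "b 5 z = 2 * H z * J z + 4 * (\<Xi> z)\<^sup>2 * (a2 z * J z / a1 z + (J z)\<^sup>2 / (3 * a1 z) * I1 f z)"
    "b 6 z = 4 * (\<Xi> z)\<^sup>2 * ((J z)\<^sup>2 / a1 z)"
    "b 9 z = I8 f (J z) (a2 z) z - a2 z" "b 10 z = I3 f z - J z" "b 11 z = - a2 z / J z" "b 12 z = 1 / a1 z"
    "b 13 z = I9 f (J z) (a1 z) (a2 z) z - ((a2 z)\<^sup>2 / (2 * a1 z) + (J z)\<^sup>2 / (2 * a1 z) * I2 f z)"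
    "b 14 z = I10 f (J z) (a1 z) (a2 z) z - (a2 z * J z / a1 z + (J z)\<^sup>2 / (3 * a1 z) * I1 f z)"
    "b 15 z = I3 f z * J z / a1 z - (J z)\<^sup>2 / a1 z"
    "b 16 z = - (1 / (2 * a1 z)) * (I2 f z * J z + (a2 z)\<^sup>2 / J z)" "b 17 z = 1 / a1 z" for z
    by (simp_all add: b_def bcoeff_def)
  have b78: "b 7 z = jet_u ?\<Phi> z * dxu ?\<Phi> z" "b 8 z = dxu ?\<Phi> z" if "z \<in> U" for z
    unfolding b7_b8(1)[OF that, symmetric] by (simp add: b_def bcoeff_def)
      (use b7_b8(2)[OF that] in \<open>simp add: b_def bcoeff_def\<close>)
  have A1_pd: "Dhat f (A1 \<circ> xup) z = Dhat f a1 z" "pd i (A1 \<circ> xup) z = pd i a1 z" if z: "z \<in> U" for z i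
    by (rule Dhat_cong[OF assms(1) hola1 _ z] pd_cong[OF assms(1) hola1 _ z], simp add: A1)+
  have eta_pd: "Dhat f \<eta> z = Dhat f H z" "pd i \<eta> z = pd i H z" if z: "z \<in> U" for z i
    by (rule Dhat_cong[OF assms(1) holH eta z] pd_cong[OF assms(1) holH eta z], assumption)+
  have M: "Bmat (\<lambda>i. b i z) = matrix_inv (Mmat (\<xi> z) (\<eta> z)) ** Nmat f (J z) (A1 (xup z)) (a2 z) z"
    if "z \<in> U" for z
    unfolding b_def xi eta[OF that, symmetric] A1[OF that] by (rule Bmat_bcoeff[OF Xi_nonzero[OF that]])
  have "?P A1 a2 J b"
  proof (intro conjI holA1 hola2 holJ ballI)
    fix z assume z: "z \<in> U"
    note nz = a1_nonzero[OF z] J_nonzero[OF z]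
    note eqs = A1_pd[OF z] eta_pd[OF z] b b78[OF z] xi eta[OF z, symmetric] fbar_def
    show "A1 (xup z) \<noteq> 0" "J z \<noteq> 0" using nz by (simp_all add: A1[OF z])
    show "(J z)\<^sup>2 = I5 f z" by (simp add: I5[OF z] J_def)
    show "Bmat (\<lambda>i. b i z) = matrix_inv (Mmat (\<xi> z) (\<eta> z)) ** Nmat f (J z) (A1 (xup z)) (a2 z) z"
      by (rule M[OF z])
    show "Dhat f a2 z = - b 16 z / b 17 z" "pd 2 a2 z = - b 13 z / b 17 z"
      "pd 3 a2 z = - b 14 z / b 17 z" "pd 4 a2 z = - b 15 z / b 17 z"
      unfolding eqs a2_D[OF z] a2_u[OF z] a2_p[OF z] a2_q[OF z] using nz by (simp_all add: field_simps)
    show "Dhat f (A1 \<circ> xup) z = - b 11 z / b 12 z" "pd 2 (A1 \<circ> xup) z = - b 9 z / b 12 z"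
      "pd 3 (A1 \<circ> xup) z = - b 10 z / b 12 z" "pd 4 (A1 \<circ> xup) z = 0"
      unfolding eqs a1_system[OF z] using nz by (simp_all add: field_simps)
    show "Dhat f \<eta> z = b 8 z * fbar z" "pd 2 \<eta> z = b 4 z + b 7 z * fbar z"
      "pd 3 \<eta> z = b 5 z" "pd 4 \<eta> z = b 6 z"
      unfolding eqs H_system[OF z] by simp_all
    show "Dhat f \<xi> z = b 8 z * \<eta> z" "pd 2 \<xi> z = b 2 z + b 7 z * \<eta> z" "pd 3 \<xi> z = b 3 z"
      unfolding eqs Xi_system[OF z] by simp_all
    show "Dhat f ?\<Phi> z = b 8 z" "pd 2 ?\<Phi> z = b 7 z"
      unfolding eqs Phi_system[OF z] by simp_all
    show "b 7 z * Dhat f ?\<Psi> z = b 8 z * (pd 2 ?\<Psi> z - b 1 z)"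
      unfolding eqs Phi_system[OF z] by (rule last_equation[OF z])
  qed
  then show ?thesis by blast
qed

end
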